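(* Let $p$ be a prime number. Suppose given an odd integer $\lambda_p \geq 1$ and, for each prime number $l$ (including $l = p$), an integer $\mu_l \geq 0$, such that $\mu_l = 0$ for all but finitely many $l$. Then there exists an unramified $\mathbb{Z}_p$-covering $X_\infty/X$ of connected graphs such that $\lambda_p(X_\infty/X) = \lambda_p$ and $\mu_l(X_\infty/X) = \mu_l$ for every prime $l$. Indeed, such a covering exists with $X$ a bouquet (i.e., a graph with a single vertex).
   Context: Graphs (Serre's formalism): a graph $X$ consists of finite sets $V_X$ (vertices) and $\mathbb{E}_X$ (edges, oriented), an involution $e \mapsto \overline{e}$ of $\mathbb{E}_X$ without fixed elements, and maps $s,t:\mathbb{E}_X \to V_X$ with $s(\overline{e}) = t(e)$, $t(\overline{e}) = s(e)$. So multi-edges and loops are allowed, and each pair $\{e,\overline{e}\}$ is one undirected edge. $\kappa_X$ denotes the number of spanning trees of $X$ (as an undirected multigraph, undirected edges being the pairs $\{e,\overline e\}$). Unramified $\mathbb{Z}_p$-coverings: let $\Gamma$ be a profinite group, written multiplicatively, isomorphic to $\mathbb{Z}_p$, and $\Gamma_n = \Gamma/\Gamma^{p^n}$ for $n \ge 0$. A voltage assignment is a map $\alpha: \mathbb{E}_X \to \Gamma$ with $\alpha(\overline{e}) = \alpha(e)^{-1}$ for all $e$. The derived graph $X_n$ has $V_{X_n} = \Gamma_n \times V_X$, $\mathbb{E}_{X_n} = \Gamma_n \times \mathbb{E}_X$, with $\overline{(\gamma,e)} = (\gamma\cdot\alpha(e),\overline{e})$, $s((\gamma,e)) = (\gamma,s(e))$,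 $t((\gamma,e)) = (\gamma\cdot\alpha(e),t(e))$. The tower $X = X_0 \leftarrow X_1 \leftarrow X_2 \leftarrow\cdots$ (with maps induced by the projections $\Gamma_{n'} \to \Gamma_n$), provided all $X_n$ are connected, is an unramified $\mathbb{Z}_p$-covering of connected graphs, written $X_\infty/X$; every unramified $\mathbb{Z}_p$-covering of connected graphs is, up to isomorphism, of this form, and this may be taken as the definition. Invariants: $\operatorname{ord}_l$ denotes the $l$-adic valuation with $\operatorname{ord}_l(l)=1$. It is known that there are unique non-negative integers $\lambda_p(X_\infty/X)$, $\mu_p(X_\infty/X)$ and an integer $\nu_p$ with $\operatorname{ord}_p(\kappa_{X_n}) = \lambda_p(X_\infty/X)\, n + \mu_p(X_\infty/X)\, p^n + \nu_p$ for all sufficiently large $n$; and for each prime $l \ne p$ there are a unique non-negative integer $\mu_l(X_\infty/X)$ and an integer $\nu_l$ with $\operatorname{ord}_l(\kappa_{X_n}) = \mu_l(X_\infty/X)\, p^n + \nu_l$ for all sufficiently large $n$. *)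

theory Defs
  imports
    "HOL-Algebra.Coset"
    "HOL-Computational_Algebra.Primes"
    "Graph_Theory.Bidirected_Digraph"
    "Graph_Theory.Digraph_Component"
begin

text \<open>
  A finite graph in Serre's formalism is a \<^locale>\<open>fin_digraph\<close> \<open>X\<close> which is a
  \<^locale>\<open>bidirected_digraph\<close> with respect to the inversion \<open>arev\<close>: that locale says that
  \<open>arev\<close> is an involution whose non-fixed points are exactly the (oriented) edges and which
  exchanges origin (\<^const>\<open>tail\<close>) and terminus (\<^const>\<open>head\<close>). Loops and multiple edges
  are allowed. Outside the set of edges \<open>arev\<close> is the identity, by convention.
\<close>

section \<open>Spanning trees\<close>

text \<open>
  A directed cycle is a closed walk with distinct vertices; the only ones
  which are not circuits of the underlying undirected graph are those that run through an edge
  and then back through its inverse.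
\<close>

definition circuit :: "('v, 'e) pre_digraph \<Rightarrow> ('e \<Rightarrow> 'e) \<Rightarrow> 'e list \<Rightarrow> bool" where
  "circuit G arev c \<longleftrightarrow> pre_digraph.cycle G c \<and> (\<forall>e \<in> set c. arev e \<notin> set c)"

text \<open>
  A set of undirected edges \<open>{e, arev e}\<close> is encoded as the \<open>arev\<close>-stable set of
  oriented edges which is its union.
\<close>

definition spanning_trees :: "('v, 'e) pre_digraph \<Rightarrow> ('e \<Rightarrow> 'e) \<Rightarrow> 'e set set" where
  "spanning_trees G arev =
     {T. T \<subseteq> arcs G \<and> arev ` T = T \<and>
         Digraph_Component.connected (G\<lparr>arcs := T\<rparr>) \<and>
         (\<nexists>c. circuit (G\<lparr>arcs := T\<rparr>) arev c)}"

definition num_spanning_trees :: "('v, 'e) pre_digraph \<Rightarrow> ('e \<Rightarrow> 'e) \<Rightarrow> nat" where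
  "num_spanning_trees G arev = card (spanning_trees G arev)"


section \<open>Unramified \<open>\<int>\<^sub>p\<close>-coverings\<close>

text \<open>The additive group of \<open>p\<close>-adic integers, as the inverse limit of the \<open>\<int>/p\<^sup>n\<int>\<close>.\<close>

definition Zp :: "nat \<Rightarrow> (nat \<Rightarrow> int) monoid" where
  "Zp p = \<lparr>carrier = {x. \<forall>n. x n \<in> {0..<int p ^ n} \<and> x (Suc n) mod int p ^ n = x n},
           monoid.mult = (\<lambda>x y n. (x n + y n) mod int p ^ n),
           one = (\<lambda>n. 0)\<rparr>"

definition level_subgroup :: "nat \<Rightarrow> 'g monoid \<Rightarrow> nat \<Rightarrow> 'g set" where
  "level_subgroup p \<Gamma> n = (\<lambda>g. g [^]\<^bsub>\<Gamma>\<^esub> (p ^ n)) ` carrier \<Gamma>"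

definition level_group :: "nat \<Rightarrow> 'g monoid \<Rightarrow> nat \<Rightarrow> 'g set monoid" where
  "level_group p \<Gamma> n = \<Gamma> Mod level_subgroup p \<Gamma> n"

text \<open>The product \<open>\<gamma> \<cdot> a\<close> in \<open>\<Gamma>\<^sub>n\<close> of \<open>\<gamma> \<in> \<Gamma>\<^sub>n\<close> and the image of \<open>a \<in> \<Gamma>\<close>.\<close>

definition level_mult :: "nat \<Rightarrow> 'g monoid \<Rightarrow> nat \<Rightarrow> 'g set \<Rightarrow> 'g \<Rightarrow> 'g set" where
  "level_mult p \<Gamma> n \<gamma> a = \<gamma> \<otimes>\<^bsub>level_group p \<Gamma> n\<^esub> (level_subgroup p \<Gamma> n #>\<^bsub>\<Gamma>\<^esub> a)"

definition derived_graph ::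
  "nat \<Rightarrow> 'g monoid \<Rightarrow> ('v, 'e) pre_digraph \<Rightarrow> ('e \<Rightarrow> 'g) \<Rightarrow> nat
     \<Rightarrow> ('g set \<times> 'v, 'g set \<times> 'e) pre_digraph" where
  "derived_graph p \<Gamma> X \<alpha> n =
     \<lparr>verts = carrier (level_group p \<Gamma> n) \<times> verts X,
      arcs = carrier (level_group p \<Gamma> n) \<times> arcs X,
      tail = (\<lambda>(\<gamma>, e). (\<gamma>, tail X e)),
      head = (\<lambda>(\<gamma>, e). (level_mult p \<Gamma> n \<gamma> (\<alpha> e), head X e))\<rparr>"

definition derived_arev ::
  "nat \<Rightarrow> 'g monoid \<Rightarrow> ('v, 'e) pre_digraph \<Rightarrow> ('e \<Rightarrow> 'e) \<Rightarrow> ('e \<Rightarrow> 'g) \<Rightarrow> nat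
     \<Rightarrow> 'g set \<times> 'e \<Rightarrow> 'g set \<times> 'e" where
  "derived_arev p \<Gamma> X arev \<alpha> n =
     (\<lambda>(\<gamma>, e). if (\<gamma>, e) \<in> arcs (derived_graph p \<Gamma> X \<alpha> n)
               then (level_mult p \<Gamma> n \<gamma> (\<alpha> e), arev e) else (\<gamma>, e))"

text \<open>
  The covering \<open>X\<^sub>\<infinity>/X\<close> is represented by the data \<open>(\<Gamma>, X, arev, \<alpha>)\<close> from which the tower
  of the derived graphs \<open>X\<^sub>n\<close> is built. The profinite topology of \<open>\<Gamma>\<close> is not mentioned: it is
  given by the subgroups \<open>\<Gamma>\<^bsup>p^n\<^esup>\<close>, and hence determined by the abstract group. Connectedness of
  \<open>X\<close> itself is the case \<open>n = 0\<close>.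
\<close>

definition Zp_covering ::
  "nat \<Rightarrow> 'g monoid \<Rightarrow> ('v, 'e) pre_digraph \<Rightarrow> ('e \<Rightarrow> 'e) \<Rightarrow> ('e \<Rightarrow> 'g) \<Rightarrow> bool" where
  "Zp_covering p \<Gamma> X arev \<alpha> \<longleftrightarrow>
     group \<Gamma> \<and> \<Gamma> \<cong> Zp p \<and>
     fin_digraph X \<and> bidirected_digraph X arev \<and>
     (\<forall>e \<in> arcs X. \<alpha> e \<in> carrier \<Gamma> \<and> \<alpha> (arev e) = inv\<^bsub>\<Gamma>\<^esub> (\<alpha> e)) \<and>
     (\<forall>n. Digraph_Component.connected (derived_graph p \<Gamma> X \<alpha> n))"


section \<open>The invariants\<close>

text \<open>The sequence \<open>ord\<^sub>l (\<kappa> (X\<^sub>n))\<close>.\<close>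

definition ord_kappa ::
  "nat \<Rightarrow> nat \<Rightarrow> 'g monoid \<Rightarrow> ('v, 'e) pre_digraph \<Rightarrow> ('e \<Rightarrow> 'e) \<Rightarrow> ('e \<Rightarrow> 'g) \<Rightarrow> nat \<Rightarrow> nat" where
  "ord_kappa l p \<Gamma> X arev \<alpha> n =
     multiplicity l (num_spanning_trees (derived_graph p \<Gamma> X \<alpha> n) (derived_arev p \<Gamma> X arev \<alpha> n))"

definition growth :: "nat \<Rightarrow> (nat \<Rightarrow> nat) \<Rightarrow> nat \<Rightarrow> nat \<Rightarrow> int \<Rightarrow> bool" where
  "growth p f lam mu nu \<longleftrightarrow>
     (\<forall>\<^sub>F n in sequentially. int (f n) = int lam * int n + int mu * int p ^ n + nu)"

definition lambda_inv ::
  "nat \<Rightarrow> 'g monoid \<Rightarrow> ('v, 'e) pre_digraph \<Rightarrow> ('e \<Rightarrow> 'e) \<Rightarrow> ('e \<Rightarrow> 'g) \<Rightarrow> nat" where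
  "lambda_inv p \<Gamma> X arev \<alpha> =
     (THE lam. \<exists>mu nu. growth p (ord_kappa p p \<Gamma> X arev \<alpha>) lam mu nu)"

text \<open>For \<open>l \<noteq> p\<close> there is no linear term in the growth formula.\<close>

definition mu_inv ::
  "nat \<Rightarrow> nat \<Rightarrow> 'g monoid \<Rightarrow> ('v, 'e) pre_digraph \<Rightarrow> ('e \<Rightarrow> 'e) \<Rightarrow> ('e \<Rightarrow> 'g) \<Rightarrow> nat" where
  "mu_inv l p \<Gamma> X arev \<alpha> =
     (THE mu. \<exists>lam nu. (l \<noteq> p \<longrightarrow> lam = 0) \<and> growth p (ord_kappa l p \<Gamma> X arev \<alpha>) lam mu nu)"

lemma growth_unique:
  assumes p: "p \<ge> 2" and g: "growth p f a b c" and g': "growth p f a' b' c'"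
  shows "a = a'" and "b = b'"
proof -
  define d where "d = int a - int a'"
  define m where "m = int b - int b'"
  define k where "k = c - c'"
  have "\<forall>\<^sub>F n in sequentially. d * int n + m * int p ^ n + k = 0"
    using eventually_conj[OF g[unfolded growth_def] g'[unfolded growth_def]]
    by (rule eventually_mono) (auto simp: d_def m_def k_def algebra_simps)
  then obtain N where N: "\<And>n. n \<ge> N \<Longrightarrow> d * int n + m * int p ^ n + k = 0"
    by (auto simp: eventually_sequentially)
  have e: "d + m * int p ^ n * (int p - 1) = 0" if "n \<ge> N" for n
    using N[of n] N[of "Suc n"] that by (simp add: algebra_simps)
  have "m * int p ^ N * (int p - 1) * (int p - 1) = 0"
    using e[of N] e[of "Suc N"] by (simp add: algebra_simps)
  then have "m = 0" using p by auto
  moreover from this have "d = 0" using e[of N] by simp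
  ultimately show "a = a'" "b = b'" by (auto simp: d_def m_def)
qed

lemma lambda_inv_eqI:
  assumes "p \<ge> 2" "growth p (ord_kappa p p \<Gamma> X arev \<alpha>) lam mu nu"
  shows "lambda_inv p \<Gamma> X arev \<alpha> = lam"
  unfolding lambda_inv_def using assms growth_unique(1)[OF assms(1)] by blast

lemma mu_inv_eqI:
  assumes "p \<ge> 2" "growth p (ord_kappa l p \<Gamma> X arev \<alpha>) lam mu nu" "l \<noteq> p \<Longrightarrow> lam = 0"
  shows "mu_inv l p \<Gamma> X arev \<alpha> = mu"
  unfolding mu_inv_def using assms growth_unique(2)[OF assms(1)] by blast

end

theory Submission
  imports Defs "Jordan_Normal_Form.Char_Poly" "HOL-Number_Theory.Cong"
begin

text \<open>
  Let \<open>X\<close> be a bouquet whose loops carry voltages \<open>a\<^sub>1, a\<^sub>2, \<dots>\<close> in \<open>\<int> \<subseteq> \<int>\<^sub>p\<close>. Then \<open>X\<^sub>n\<close> is a Cayley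
  multigraph of \<open>\<int>/p\<^sup>n\<close>, so its Laplacian is diagonalised by the characters of that group, and the
  matrix-tree theorem (\<open>matrix_tree\<close>) yields
  \<open>p\<^sup>n \<cdot> \<kappa>(X\<^sub>n) = \<Prod> (\<Sum>\<^sub>i 2 - z^a\<^sub>i - z^-a\<^sub>i)\<close>,
  the product being over the roots of unity \<open>z \<noteq> 1\<close> with \<open>z^(p^n) = 1\<close>
  (\<open>spanning_trees_product\<close>). Sorted by the order of \<open>z\<close>, the right hand side becomes a product of
  \<open>n\<close> integers, the norms of one element of the rings \<open>\<int>[z]\<close>, \<open>z\<close> of order \<open>p, p\<^sup>2, \<dots>, p\<^sup>n\<close>.
  Hence the invariants can be read off from the \<open>l\<close>-adic valuations of these norms at high levels.

  Write \<open>lam + 1 = 2 k\<close> and let \<open>N\<close> be the product of the prime powers \<open>l^(mu l)\<close>. Take \<open>N c\<^sub>a\<close>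
  loops of voltage \<open>a\<close> for \<open>1 \<le> a \<le> k\<close>, with positive integers \<open>c\<^sub>a\<close>. The factor belonging to \<open>z\<close> is
  \<open>N z^-k G(z)\<close> with \<open>G = \<Sum>\<^sub>a c\<^sub>a (2 T^k - T^(k+a) - T^(k-a))\<close>, and the \<open>p\<^sup>n - 1\<close> factors \<open>N\<close> provide
  the required \<open>mu l\<close>. It remains to choose the \<open>c\<^sub>a\<close> such that \<open>G\<close> contributes \<open>lam\<close> and nothing else.

  \<^item> By the binomial theorem \<open>-(T - 1)^(2k)\<close> is an integral combination of the polynomials
    \<open>2 T^k - T^(k+a) - T^(k-a)\<close>, in which the one for \<open>a = k\<close> has coefficient 1. Some of
    the coefficients are negative, which no number of loops can be. However, only their residues modulo \<open>p\<close> matter,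
    and these are represented by positive numbers \<open>c\<^sub>a\<close>. So \<open>G \<equiv> -(T - 1)^(2k)\<close> modulo \<open>p\<close>. As \<open>z - 1\<close>
    has norm of \<open>p\<close>-adic valuation 1 and the ramification index of \<open>\<int>[z]\<close> eventually exceeds \<open>2 k\<close>, the norm
    of \<open>G(z)\<close> has valuation exactly \<open>2 k\<close> at every high level (\<open>multiplicity_root_norm_p\<close>). The factor
    \<open>p\<^sup>n\<close> of \<open>\<kappa>(X\<^sub>n)\<close> subtracts 1 per level, and \<open>2 k - 1 = lam\<close>.

  \<^item> Because \<open>c\<^sub>k = 1\<close>, the polynomial \<open>G\<close> is monic up to sign. Let \<open>l \<noteq> p\<close> be prime. The ring \<open>\<int>[T]/(l, G)\<close>
    is finite, so \<open>T^j - T^i\<close> lies in the ideal \<open>(l, G)\<close> for some \<open>i < j\<close>. At a root of unity \<open>z\<close> of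
    \<open>p\<close>-power order \<open>> j\<close> the element \<open>z^j - z^i\<close> divides a power of \<open>p\<close>, so \<open>G(z)\<close> is
    invertible modulo \<open>l\<close>, and its norm is prime to \<open>l\<close> (\<open>root_norm_coprime_other\<close>).

  \<^item> As all \<open>c\<^sub>a\<close> are positive, the factors \<open>\<Sum>\<^sub>a N c\<^sub>a |1 - z^a|\<^sup>2\<close> do not vanish. So \<open>\<kappa>(X\<^sub>n) \<noteq> 0\<close>, which
    says that \<open>X\<^sub>n\<close> is connected.
\<close>

section \<open>Spanning trees as rooted in-trees\<close>

text \<open>
  A path that used an arc in both directions would visit one of its ends twice.
\<close>

lemma (in wf_digraph) apath_no_reversed_arcs:
  assumes p: "apath u p v" and x: "x \<in> set p" and y: "y \<in> set p"
    and rev: "tail G y = head G x" "head G y = tail G x"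
  shows False
proof -
  let ?w = "awalk_verts u p"
  have cas: "cas u p v" and dist: "distinct ?w" using p by (auto simp: apath_def awalk_def)
  have len: "length ?w = Suc (length p)" by (rule length_awalk_verts)
  have t: "?w ! i = tail G (p ! i)" and h: "?w ! Suc i = head G (p ! i)" if "i < length p" for i
  proof -
    have "p \<noteq> []" using that by auto
    then show "?w ! i = tail G (p ! i)" using that by (simp add: awalk_verts_conv nth_append)
    show "?w ! Suc i = head G (p ! i)" using that \<open>p \<noteq> []\<close> by (simp add: awalk_verts_conv'[OF cas])
  qed
  obtain i j where i: "i < length p" "p ! i = x" and j: "j < length p" "p ! j = y"
    using x y by (auto simp: in_set_conv_nth)
  have "?w ! i = ?w ! Suc j" "?w ! Suc i = ?w ! j" using t h i j rev by metis+
  then have "i = Suc j" "Suc i = j"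
    using nth_eq_iff_index_eq[OF dist] i j len by auto
  then show False by simp
qed

lemma (in pre_digraph) closed_cas_tails_eq_heads:
  assumes "cas u p u" "p \<noteq> []"
  shows "tail G ` set p = head G ` set p"
proof -
  have "cas u p v \<Longrightarrow> insert v (tail G ` set p) = insert u (head G ` set p)" for v
    by (induction p arbitrary: u) auto
  then have "insert u (tail G ` set p) = insert u (head G ` set p)" using assms by blast
  moreover have "u \<in> tail G ` set p" using assms by (cases p) auto
  moreover have "cas u p v \<Longrightarrow> p \<noteq> [] \<Longrightarrow> v \<in> head G ` set p" for v
    by (induction p arbitrary: u) (auto split: if_splits, metis cas.simps(1))
  then have "u \<in> head G ` set p" using assms by blast
  ultimately show ?thesis by (simp add: insert_absorb)
qed

locale rooted_graph = fin_digraph G + bidirected_digraph G arev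
  for G :: "('v, 'e) pre_digraph" and arev :: "'e \<Rightarrow> 'e" +
  fixes r :: 'v
  assumes root: "r \<in> verts G"
begin

text \<open>
  A spanning tree is encoded by its orientation towards the root \<open>r\<close>: every other vertex selects
  the arc leading to its parent. Among all such selections the trees are those for which iterating
  the parent map always ends in \<open>r\<close>.
\<close>

definition parent_maps :: "('v \<Rightarrow> 'e) set" where
  "parent_maps = PiE (verts G - {r}) (out_arcs G)"

definition parent :: "('v \<Rightarrow> 'e) \<Rightarrow> 'v \<Rightarrow> 'v" where
  "parent F v = (if v = r then r else head G (F v))"

definition in_trees :: "('v \<Rightarrow> 'e) set" where
  "in_trees = {F \<in> parent_maps. \<forall>v \<in> verts G. \<exists>k. (parent F ^^ k) v = r}"

definition tree_arcs :: "('v \<Rightarrow> 'e) \<Rightarrow> 'e set" where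
  "tree_arcs F = F ` (verts G - {r}) \<union> arev ` F ` (verts G - {r})"

definition depth :: "('v \<Rightarrow> 'e) \<Rightarrow> 'v \<Rightarrow> nat" where
  "depth F v = (LEAST k. (parent F ^^ k) v = r)"

lemma parent_mapsD:
  assumes "F \<in> parent_maps" "v \<in> verts G" "v \<noteq> r"
  shows "F v \<in> arcs G" "tail G (F v) = v"
  using assms by (auto simp: parent_maps_def PiE_def Pi_def out_arcs_def)

lemma parent_funpow_Suc:
  "v \<noteq> r \<Longrightarrow> (parent F ^^ Suc k) v = (parent F ^^ k) (head G (F v))"
  by (simp add: funpow_Suc_right parent_def del: funpow.simps)

lemma depth_parent:
  assumes F: "F \<in> in_trees" and v: "v \<in> verts G" "v \<noteq> r"
  shows "depth F v = Suc (depth F (head G (F v)))"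
proof -
  obtain k where k: "(parent F ^^ k) v = r" using F v by (auto simp: in_trees_def)
  have "depth F v = Suc (LEAST k. (parent F ^^ Suc k) v = r)"
    unfolding depth_def by (rule Least_Suc[of "\<lambda>k. (parent F ^^ k) v = r", OF k]) (use v in simp)
  also have "(\<lambda>k. (parent F ^^ Suc k) v = r) = (\<lambda>k. (parent F ^^ k) (head G (F v)) = r)"
    using parent_funpow_Suc[OF v(2)] by simp
  finally show ?thesis by (simp add: depth_def)
qed

lemma tree_arcs_cases:
  assumes F: "F \<in> parent_maps" and e: "e \<in> tree_arcs F"
  obtains v where "v \<in> verts G" "v \<noteq> r" "e = F v" "tail G e = v"
    | v where "v \<in> verts G" "v \<noteq> r" "e = arev (F v)" "head G e = v" "tail G e = head G (F v)"
  using assms parent_mapsD[OF F] unfolding tree_arcs_def by fastforce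

lemma tree_arcs_stable:
  assumes F: "F \<in> parent_maps"
  shows "tree_arcs F \<subseteq> arcs G" "arev ` tree_arcs F = tree_arcs F"
proof -
  show "tree_arcs F \<subseteq> arcs G"
    unfolding tree_arcs_def using parent_mapsD(1)[OF F] arev_in_arcs by blast
  show "arev ` tree_arcs F = tree_arcs F"
    by (simp add: tree_arcs_def image_Un image_image Un_commute)
qed

lemma wf_sub: "T \<subseteq> arcs G \<Longrightarrow> wf_digraph (G\<lparr>arcs := T\<rparr>)"
  by unfold_locales auto

lemma sub_reachable_sym:
  assumes "T \<subseteq> arcs G" "arev ` T = T"
  shows "sym (arcs_ends (G\<lparr>arcs := T\<rparr>))"
proof (rule symI)
  fix u v assume "(u, v) \<in> arcs_ends (G\<lparr>arcs := T\<rparr>)"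
  then obtain e where e: "e \<in> T" "tail G e = u" "head G e = v" by (auto simp: arcs_ends_conv)
  then have "arev e \<in> T" "e \<in> arcs G" using assms by auto
  then show "(v, u) \<in> arcs_ends (G\<lparr>arcs := T\<rparr>)" using e
    by (auto simp: arcs_ends_conv intro!: image_eqI[of _ _ "arev e"])
qed

lemma connected_sub_iff:
  assumes T: "T \<subseteq> arcs G" "arev ` T = T"
  shows "Digraph_Component.connected (G\<lparr>arcs := T\<rparr>) \<longleftrightarrow>
    (\<forall>u \<in> verts G. \<forall>v \<in> verts G. u \<rightarrow>\<^sup>*\<^bsub>G\<lparr>arcs := T\<rparr>\<^esub> v)"
proof -
  have "symcl (arcs_ends (G\<lparr>arcs := T\<rparr>)) = arcs_ends (G\<lparr>arcs := T\<rparr>)"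
    using sub_reachable_sym[OF T] by (auto simp: symcl_def sym_def)
  then show ?thesis
    using root unfolding connected_conv reachable_def by auto
qed

lemma in_tree_connected:
  assumes F: "F \<in> in_trees"
  shows "Digraph_Component.connected (G\<lparr>arcs := tree_arcs F\<rparr>)"
proof -
  have Fm: "F \<in> parent_maps" using F by (simp add: in_trees_def)
  let ?H = "G\<lparr>arcs := tree_arcs F\<rparr>"
  have to_root: "v \<in> verts G \<Longrightarrow> (parent F ^^ k) v = r \<Longrightarrow> (v, r) \<in> rtrancl_on (verts G) (arcs_ends ?H)" for v k
  proof (induction k arbitrary: v)
    case 0
    then show ?case by simp
  next
    case (Suc k)
    show ?case
    proof (cases "v = r")
      case False
      let ?u = "head G (F v)"
      have 1: "F v \<in> arcs G" "tail G (F v) = v" using parent_mapsD[OF Fm Suc.prems(1) False] by auto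
      have "(parent F ^^ k) ?u = r" using Suc.prems(2) parent_funpow_Suc[OF False] by simp
      then have A: "(?u, r) \<in> rtrancl_on (verts G) (arcs_ends ?H)" using 1 Suc.IH by simp
      have "F v \<in> tree_arcs F" using Suc.prems(1) False by (simp add: tree_arcs_def)
      then have B: "(v, ?u) \<in> arcs_ends ?H" using 1 by (auto simp: arcs_ends_conv intro!: image_eqI[of _ _ "F v"])
      show ?thesis by (rule converse_rtrancl_on_into_rtrancl_on[OF B A Suc.prems(1)])
    qed (use root in simp)
  qed
  have all: "(v, r) \<in> rtrancl_on (verts G) (arcs_ends ?H)" if "v \<in> verts G" for v
    using F that to_root by (auto simp: in_trees_def)
  have "sym (rtrancl_on (verts G) (arcs_ends ?H))"
    by (intro rtrancl_on_sym sub_reachable_sym tree_arcs_stable Fm)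
  then have "(r, v) \<in> rtrancl_on (verts G) (arcs_ends ?H)" if "v \<in> verts G" for v
    using all[OF that] by (rule symD)
  then show ?thesis
    unfolding connected_sub_iff[OF tree_arcs_stable[OF Fm]] reachable_def
    using all by (auto intro: rtrancl_on_trans)
qed

text \<open>
  Consider a vertex of maximal depth on a closed walk in the tree. Both the arc by which the walk
  leaves it and the arc by which the walk enters it must lie on the edge to its parent, so the walk
  backtracks there.
\<close>

lemma in_tree_no_circuit:
  assumes F: "F \<in> in_trees"
  shows "\<not> circuit (G\<lparr>arcs := tree_arcs F\<rparr>) arev c"
proof
  let ?H = "G\<lparr>arcs := tree_arcs F\<rparr>"
  have Fm: "F \<in> parent_maps" using F by (simp add: in_trees_def)
  assume "circuit ?H arev c"
  then obtain u where c: "pre_digraph.cas ?H u c u" "set c \<subseteq> tree_arcs F" "c \<noteq> []"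
    and norev: "\<And>e. e \<in> set c \<Longrightarrow> arev e \<notin> set c"
    by (auto simp: circuit_def pre_digraph.cycle_def pre_digraph.awalk_def)
  have ends: "tail G ` set c = head G ` set c"
    using pre_digraph.closed_cas_tails_eq_heads[OF c(1,3)] by simp
  define m where "m = Max (depth F ` tail G ` set c)"
  have "m \<in> depth F ` tail G ` set c" unfolding m_def using c(3) by (intro Max_in) auto
  then obtain e where e: "e \<in> set c" "depth F (tail G e) = m" by auto
  have max: "depth F (tail G x) \<le> m" "depth F (head G x) \<le> m" if "x \<in> set c" for x
    unfolding m_def using that ends by (auto intro!: Max_ge)
  let ?v = "tail G e"
  have eF: "e = F ?v \<and> ?v \<noteq> r \<and> ?v \<in> verts G"
  proof (rule tree_arcs_cases[OF Fm subsetD[OF c(2) e(1)]])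
    fix w assume w: "w \<in> verts G" "w \<noteq> r" "head G e = w" "tail G e = head G (F w)"
    then have "depth F (head G e) = Suc m" using depth_parent[OF F w(1,2)] e by simp
    then show ?thesis using max(2)[OF e(1)] by simp
  qed auto
  obtain x where x: "x \<in> set c" "head G x = ?v" using ends e by (metis image_iff)
  have "x = arev (F ?v)"
  proof (rule tree_arcs_cases[OF Fm subsetD[OF c(2) x(1)]])
    fix w assume w: "w \<in> verts G" "w \<noteq> r" "x = F w" "tail G x = w"
    then have "depth F (tail G x) = Suc m" using depth_parent[OF F w(1,2)] e x by simp
    then show ?thesis using max(1)[OF x(1)] by simp
  qed (use x in auto)
  then have "x = arev e" using eF by simp
  then show False using norev e(1) x(1) by simp
qed

lemma tree_arcs_in_spanning_trees:
  "F \<in> in_trees \<Longrightarrow> tree_arcs F \<in> spanning_trees G arev"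
  using tree_arcs_stable[of F] in_tree_connected in_tree_no_circuit
  by (auto simp: spanning_trees_def in_trees_def)

text \<open>
  Suppose that two in-trees have the same edges and differ at \<open>v\<close>. The arc that the second one
  selects at \<open>v\<close> is then the reverse of an arc that the first one selects at the other end \<open>w\<close>. By
  induction on the depth both select the same arc at \<open>w\<close>, so the second one has \<open>v\<close> and \<open>w\<close> as
  parents of each other.
\<close>

lemma tree_arcs_inj: "inj_on tree_arcs in_trees"
proof (rule inj_onI)
  fix F F' assume F: "F \<in> in_trees" and F': "F' \<in> in_trees" and eq: "tree_arcs F = tree_arcs F'"
  have Fm: "F \<in> parent_maps" "F' \<in> parent_maps" using F F' by (auto simp: in_trees_def)
  have "v \<in> verts G \<Longrightarrow> v \<noteq> r \<Longrightarrow> depth F' v = k \<Longrightarrow> F v = F' v" for v k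
  proof (induction k arbitrary: v rule: less_induct)
    case (less k)
    have "F' v \<in> tree_arcs F" using less.prems unfolding eq by (simp add: tree_arcs_def)
    then show ?case
    proof (rule tree_arcs_cases[OF Fm(1)])
      fix w assume "w \<in> verts G" "F' v = F w" "tail G (F' v) = w"
      then show ?thesis using parent_mapsD[OF Fm(2) less.prems(1,2)] by simp
    next
      fix w assume w: "w \<in> verts G" "w \<noteq> r" "F' v = arev (F w)" "head G (F' v) = w" "tail G (F' v) = head G (F w)"
      have d: "depth F' v = Suc (depth F' w)" using depth_parent[OF F' less.prems(1,2)] w by simp
      then have "F w = F' w" using less.IH[of "depth F' w" w] less.prems w by simp
      then have "depth F' w = Suc (depth F' (head G (F w)))" using depth_parent[OF F' w(1,2)] by simp
      moreover have "head G (F w) = v" using w(5) parent_mapsD[OF Fm(2) less.prems(1,2)] by simp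
      ultimately show ?thesis using d by simp
    qed
  qed
  then have "F v = F' v" if "v \<in> verts G - {r}" for v using that by blast
  then show "F = F'" using Fm unfolding parent_maps_def by (intro PiE_ext) auto
qed

text \<open>
  Follow shortest paths to the root inside the given connected subgraph.
\<close>

lemma spanning_tree_contains_in_tree:
  assumes T: "T \<subseteq> arcs G" "arev ` T = T" and con: "Digraph_Component.connected (G\<lparr>arcs := T\<rparr>)"
  shows "\<exists>F \<in> in_trees. tree_arcs F \<subseteq> T"
proof -
  let ?A = "arcs_ends (G\<lparr>arcs := T\<rparr>)"
  have reach: "\<exists>k. (v, r) \<in> ?A ^^ k" if "v \<in> verts G" for v
  proof -
    have "v \<rightarrow>\<^sup>*\<^bsub>G\<lparr>arcs := T\<rparr>\<^esub> r" using con that root by (simp add: connected_sub_iff[OF T])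
    then have "(v, r) \<in> ?A\<^sup>*"
      unfolding reachable_def by (induction rule: rtrancl_on_induct) auto
    then show ?thesis by (simp add: rtrancl_power)
  qed
  define d where "d v = (LEAST k. (v, r) \<in> ?A ^^ k)" for v
  have step: "\<exists>e. e \<in> T \<and> tail G e = v \<and> d (head G e) < d v" if v: "v \<in> verts G" "v \<noteq> r" for v
  proof -
    have dv: "(v, r) \<in> ?A ^^ d v" unfolding d_def using reach[OF v(1)] by (rule LeastI_ex)
    then obtain k where k: "d v = Suc k" using v(2) by (cases "d v") auto
    then obtain w where w: "(v, w) \<in> ?A" "(w, r) \<in> ?A ^^ k" using dv by (metis relpow_Suc_D2)
    then have "d w \<le> k" unfolding d_def by (intro Least_le)
    then show ?thesis using w(1) k by (auto simp: arcs_ends_conv)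
  qed
  define F where "F = restrict (\<lambda>v. SOME e. e \<in> T \<and> tail G e = v \<and> d (head G e) < d v) (verts G - {r})"
  have F: "F v \<in> T \<and> tail G (F v) = v \<and> d (head G (F v)) < d v" if "v \<in> verts G" "v \<noteq> r" for v
    using someI_ex[OF step[OF that]] that by (simp add: F_def)
  have Fm: "F \<in> parent_maps"
    unfolding parent_maps_def
  proof (rule PiE_I)
    show "F v \<in> out_arcs G v" if "v \<in> verts G - {r}" for v using F[of v] that T(1) by auto
    show "F v = undefined" if "v \<notin> verts G - {r}" for v using that by (simp only: F_def restrict_apply if_False)
  qed
  have "v \<in> verts G \<Longrightarrow> d v = k \<Longrightarrow> \<exists>j. (parent F ^^ j) v = r" for v and k :: nat
  proof (induction k arbitrary: v rule: less_induct)
    case (less k)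
    show ?case
    proof (cases "v = r")
      case True
      then show ?thesis by (intro exI[of _ 0]) simp
    next
      case False
      let ?w = "head G (F v)"
      have "?w \<in> verts G" "d ?w < k" using F[OF less.prems(1) False] less.prems T by auto
      then obtain j where "(parent F ^^ j) ?w = r" using less.IH by blast
      then have "(parent F ^^ Suc j) v = r" using parent_funpow_Suc[OF False] by simp
      then show ?thesis by blast
    qed
  qed
  then have "F \<in> in_trees" using Fm by (auto simp: in_trees_def)
  moreover have "tree_arcs F \<subseteq> T" using F T(2) by (auto simp: tree_arcs_def)
  ultimately show ?thesis by blast
qed

text \<open>
  An edge outside a connected spanning subgraph closes a circuit with a path between its ends in
  the subgraph. With \<open>spanning_tree_contains_in_tree\<close> this makes the map from in-trees to spanning
  trees surjective.
\<close>

lemma proper_connected_sub_has_circuit: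
  assumes T: "T \<subseteq> arcs G" "arev ` T = T" and T0: "T0 \<subseteq> T" "arev ` T0 = T0"
    and con: "Digraph_Component.connected (G\<lparr>arcs := T0\<rparr>)" and e: "e \<in> T" "e \<notin> T0"
  shows "\<exists>c. circuit (G\<lparr>arcs := T\<rparr>) arev c"
proof -
  let ?H = "G\<lparr>arcs := T\<rparr>" and ?K = "G\<lparr>arcs := T0\<rparr>"
  have T0G: "T0 \<subseteq> arcs G" using T(1) T0(1) by blast
  interpret H: wf_digraph ?H using T by (intro wf_sub)
  interpret K: wf_digraph ?K using T0G by (intro wf_sub)
  have eG: "e \<in> arcs G" using e T by blast
  then have "head G e \<rightarrow>\<^sup>*\<^bsub>?K\<^esub> tail G e" using con by (simp add: connected_sub_iff[OF T0G T0(2)])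
  then obtain p where p: "K.apath (head G e) p (tail G e)" using K.reachable_apath by blast
  have arev_e: "arev e \<notin> T0" using e(2) T0(2) by (metis arev_arev imageI)
  have pT0: "set p \<subseteq> T0" using p by (auto simp: K.apath_def K.awalk_def)
  have cas_eq: "H.cas u q v = K.cas u q v" for u q v by (induction q arbitrary: u) auto
  have verts_eq: "H.awalk_verts u q = K.awalk_verts u q" for u q by (induction q arbitrary: u) auto
  have "H.awalk (tail G e) (e # p) (tail G e)"
    using p pT0 T0(1) e(1) eG by (auto simp: K.apath_def K.awalk_def H.awalk_def cas_eq)
  moreover have "distinct (tl (H.awalk_verts (tail G e) (e # p)))"
    using p by (simp add: K.apath_def verts_eq)
  ultimately have "H.cycle (e # p)" unfolding H.cycle_def by blast
  moreover have "arev x \<notin> set (e # p)" if x: "x \<in> set (e # p)" for x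
  proof
    assume a: "arev x \<in> set (e # p)"
    consider "x = e" | "x \<in> set p" "arev x = e" | "x \<in> set p" "arev x \<in> set p"
      using x a arev_neq[OF eG] by auto
    then show False
    proof cases
      case 1
      then show ?thesis using a arev_e pT0 arev_neq[OF eG] by auto
    next
      case 2
      then have "e \<in> arev ` T0" using pT0 by blast
      then show ?thesis using e(2) T0(2) by simp
    next
      case 3
      then have "x \<in> arcs G" using pT0 T0G by blast
      then show ?thesis using K.apath_no_reversed_arcs[OF p 3] by simp
    qed
  qed
  ultimately show ?thesis unfolding circuit_def by blast
qed

theorem bij_betw_in_trees_spanning_trees:
  "bij_betw tree_arcs in_trees (spanning_trees G arev)"
proof -
  have "\<exists>F \<in> in_trees. tree_arcs F = T" if "T \<in> spanning_trees G arev" for T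
  proof -
    have T: "T \<subseteq> arcs G" "arev ` T = T" "Digraph_Component.connected (G\<lparr>arcs := T\<rparr>)"
      and noc: "\<nexists>c. circuit (G\<lparr>arcs := T\<rparr>) arev c"
      using that by (auto simp: spanning_trees_def)
    obtain F where F: "F \<in> in_trees" "tree_arcs F \<subseteq> T"
      using spanning_tree_contains_in_tree[OF T] by blast
    have "tree_arcs F = T"
    proof (rule ccontr)
      assume "tree_arcs F \<noteq> T"
      then obtain e where "e \<in> T" "e \<notin> tree_arcs F" using F(2) by blast
      moreover have "F \<in> parent_maps" using F(1) by (simp add: in_trees_def)
      ultimately show False
        using proper_connected_sub_has_circuit[OF T(1,2) F(2) tree_arcs_stable(2) in_tree_connected[OF F(1)]] noc
        by blast
    qed
    then show ?thesis using F(1) by blast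
  qed
  then show ?thesis
    using tree_arcs_in_spanning_trees tree_arcs_inj by (auto simp: bij_betw_def)
qed

lemma num_spanning_trees_eq: "num_spanning_trees G arev = card in_trees"
  unfolding num_spanning_trees_def using bij_betw_same_card[OF bij_betw_in_trees_spanning_trees] by simp

lemma finite_parent_maps: "finite parent_maps"
  unfolding parent_maps_def by (intro finite_PiE) auto

end

section \<open>The matrix-tree theorem\<close>

text \<open>
  The Laplacian of the graph in which each vertex \<open>i \<noteq> 0\<close> has the single out-arc \<open>i \<rightarrow> g i\<close>, with
  the row and the column of the root 0 removed; index \<open>i\<close> stands for the vertex \<open>i + 1\<close>.
\<close>

definition functional_laplacian :: "nat \<Rightarrow> (nat \<Rightarrow> nat) \<Rightarrow> 'a::idom mat" where
  "functional_laplacian n g =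
     mat n n (\<lambda>(i, j). (if i = j then 1 else 0) - (if g (Suc i) = Suc j then 1 else 0))"

text \<open>
  Besides the identity, a permutation contributes to the Leibniz expansion only if it agrees with \<open>g\<close>
  on all points that it moves. Following \<open>g\<close> from such a point never leads to the root.
\<close>

lemma det_functional_laplacian_1:
  assumes reach: "\<And>i. i \<le> n \<Longrightarrow> \<exists>k. (g ^^ k) i = 0"
  shows "det (functional_laplacian n g :: 'a::idom mat) = 1"
proof -
  let ?M = "functional_laplacian n g :: 'a mat"
  let ?t = "\<lambda>p. signof p * (\<Prod>i = 0..<n. ?M $$ (i, p i))"
  have M: "?M \<in> carrier_mat n n" by (simp add: functional_laplacian_def)
  have entry: "?M $$ (i, j) = (if i = j then 1 else 0) - (if g (Suc i) = Suc j then 1 else 0)"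
    if "i < n" "j < n" for i j using that by (simp add: functional_laplacian_def)
  have "?t p = 0" if p: "p permutes {0..<n}" and "p \<noteq> id" for p
  proof (rule ccontr)
    assume nz: "?t p \<noteq> 0"
    have fac: "?M $$ (i, p i) \<noteq> 0" if "i < n" for i
    proof
      assume "?M $$ (i, p i) = 0"
      then have "(\<Prod>i = 0..<n. ?M $$ (i, p i)) = 0" using that by (intro prod_zero) auto
      then show False using nz by simp
    qed
    obtain i0 where "p i0 \<noteq> i0" using \<open>p \<noteq> id\<close> by (auto simp: fun_eq_iff)
    then have i0: "i0 < n" "p i0 \<noteq> i0" using p by (auto simp: permutes_def)
    have "\<exists>i<n. p i \<noteq> i \<and> (g ^^ k) (Suc i0) = Suc i" for k
    proof (induction k)
      case 0
      then show ?case using i0 by auto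
    next
      case (Suc k)
      then obtain i where i: "i < n" "p i \<noteq> i" "(g ^^ k) (Suc i0) = Suc i" by blast
      have pi: "p i < n" using permutes_nat_less[OF p i(1)] .
      have "g (Suc i) = Suc (p i)" using fac[OF i(1)] entry[OF i(1) pi] i(2) by (auto split: if_splits)
      moreover have "p (p i) \<noteq> p i" using i(2) permutes_inj[OF p] by (auto dest: injD)
      ultimately show ?case using pi i(3) by auto
    qed
    then show False using reach[of "Suc i0"] i0(1) by (metis Suc_leI nat.distinct(1))
  qed
  then have "det ?M = (\<Sum>p\<in>{id}. ?t p)"
    unfolding det_def'[OF M] by (intro sum.mono_neutral_right) (auto simp: finite_permutations permutes_id)
  also have "\<dots> = 1"
  proof -
    have "?M $$ (i, i) = 1" if i: "i < n" for i
    proof -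
      have "g (Suc i) \<noteq> Suc i"
      proof
        assume fix1: "g (Suc i) = Suc i"
        have "(g ^^ k) (Suc i) = Suc i" for k by (induction k) (simp_all add: fix1)
        then show False using reach[of "Suc i"] i by auto
      qed
      then show ?thesis using entry[OF i i] by simp
    qed
    then show ?thesis by simp
  qed
  finally show ?thesis .
qed

text \<open>
  The indicator vector of the set of the vertices from which \<open>g\<close> never reaches the root lies in the
  kernel, because \<open>i\<close> belongs to this set if and only if \<open>g i\<close> does.
\<close>

lemma det_functional_laplacian_0:
  assumes g0: "g 0 = 0" and le: "\<And>i. i \<le> n \<Longrightarrow> g i \<le> n"
    and stuck: "i0 \<le> n" "\<And>k. (g ^^ k) i0 \<noteq> 0"
  shows "det (functional_laplacian n g :: 'a::idom mat) = 0"
proof -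
  let ?M = "functional_laplacian n g :: 'a mat"
  define S where "S i \<longleftrightarrow> (\<forall>k. (g ^^ k) i \<noteq> 0)" for i
  define v :: "'a vec" where "v = vec n (\<lambda>j. if S (Suc j) then 1 else 0)"
  have S_g: "S (g i) \<longleftrightarrow> S i" if "i > 0" for i
  proof
    assume "S (g i)"
    show "S i" unfolding S_def
    proof
      fix k show "(g ^^ k) i \<noteq> 0"
        using \<open>S (g i)\<close> that by (cases k) (auto simp: S_def funpow_Suc_right simp del: funpow.simps(2))
    qed
  next
    assume "S i"
    then have "(g ^^ Suc k) i \<noteq> 0" for k unfolding S_def by blast
    then show "S (g i)" by (simp add: S_def funpow_Suc_right del: funpow.simps(2))
  qed
  have S0: "\<not> S 0" unfolding S_def by (intro notI, drule spec[of _ 0]) simp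
  have "S i0" using stuck(2) by (simp add: S_def)
  then obtain j0 where "i0 = Suc j0" using S0 by (cases i0) auto
  then have "v $ j0 = 1" "j0 < n" using \<open>S i0\<close> stuck(1) by (auto simp: v_def)
  then have v0: "v \<noteq> 0\<^sub>v n" by auto
  have "?M *\<^sub>v v = 0\<^sub>v n"
  proof (rule eq_vecI)
    fix i assume "i < dim_vec (0\<^sub>v n :: 'a vec)"
    then have i: "i < n" by simp
    have "(?M *\<^sub>v v) $ i = (\<Sum>j=0..<n. ((if i = j then 1 else 0) - (if g (Suc i) = Suc j then 1 else 0)) *
        (if S (Suc j) then 1 else 0))"
      using i by (simp add: functional_laplacian_def v_def scalar_prod_def)
    also have "\<dots> = (\<Sum>j=0..<n. (if i = j then (if S (Suc i) then 1 else 0) else 0) -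
        (if g (Suc i) = Suc j then (if S (g (Suc i)) then 1 else 0) else 0))"
      by (intro sum.cong) auto
    also have "\<dots> = (if S (Suc i) then 1 else 0) -
        (\<Sum>j=0..<n. if g (Suc i) = Suc j then (if S (g (Suc i)) then 1 else 0) else 0)"
      using i by (simp add: sum_subtractf)
    also have "(\<Sum>j=0..<n. if g (Suc i) = Suc j then (if S (g (Suc i)) then 1 else 0) else 0) =
        (if S (g (Suc i)) then 1 else (0::'a))"
      using le[of "Suc i"] i S0 by (cases "g (Suc i)") simp_all
    also have "(if S (Suc i) then 1 else 0) - (if S (g (Suc i)) then 1 else (0::'a)) = 0"
      using S_g[of "Suc i"] by simp
    finally show "(?M *\<^sub>v v) $ i = (0\<^sub>v n :: 'a vec) $ i" using i by simp
  qed (simp add: functional_laplacian_def)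
  moreover have "?M \<in> carrier_mat n n" "v \<in> carrier_vec n"
    by (simp_all add: functional_laplacian_def v_def)
  ultimately show ?thesis
    using v0 det_0_iff_vec_prod_zero by blast
qed

context rooted_graph
begin

text \<open>
  Row \<open>v\<close> of the reduced Laplacian is a sum over the arcs that leave \<open>v\<close>. Expanding the determinant
  by multilinearity in the rows, one obtains a sum over all selections of one out-arc per vertex
  of determinants of functional Laplacians, which are 1 for in-trees and 0 otherwise.
\<close>

theorem matrix_tree:
  assumes \<phi>: "bij_betw \<phi> {..<Suc n} (verts G)" and \<phi>0: "\<phi> 0 = r"
  shows "det (mat n n (\<lambda>(i, j). \<Sum>e \<in> out_arcs G (\<phi> (Suc i)).
      (if i = j then 1 else 0) - (if head G e = \<phi> (Suc j) then 1 else 0)) :: 'a::idom mat)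
    = of_nat (num_spanning_trees G arev)"
proof -
  define \<iota> where "\<iota> = the_inv_into {..<Suc n} \<phi>"
  have inj: "inj_on \<phi> {..<Suc n}" and img: "\<phi> ` {..<Suc n} = verts G" using \<phi> by (auto simp: bij_betw_def)
  have \<iota>\<phi>: "\<iota> (\<phi> i) = i" if "i \<le> n" for i
    unfolding \<iota>_def using that by (intro the_inv_into_f_f[OF inj]) simp
  have \<phi>\<iota>: "\<phi> (\<iota> v) = v" "\<iota> v \<le> n" if "v \<in> verts G" for v
  proof -
    have v: "v \<in> \<phi> ` {..<Suc n}" using that img by simp
    show "\<phi> (\<iota> v) = v" unfolding \<iota>_def by (rule f_the_inv_into_f[OF inj v])
    show "\<iota> v \<le> n" using the_inv_into_into[OF inj v order.refl] by (simp add: \<iota>_def)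
  qed
  have \<phi>V: "\<phi> i \<in> verts G" if "i \<le> n" for i using img that by auto
  have \<psi>: "bij_betw (\<lambda>i. \<phi> (Suc i)) {0..<n} (verts G - {r})"
  proof (rule bij_betwI[where g = "\<lambda>v. \<iota> v - 1"])
    show "(\<lambda>i. \<phi> (Suc i)) \<in> {0..<n} \<rightarrow> verts G - {r}"
    proof
      fix i assume i: "i \<in> {0..<n}"
      then have "\<phi> (Suc i) \<noteq> \<phi> 0" using \<iota>\<phi>[of "Suc i"] \<iota>\<phi>[of 0] by auto
      then show "\<phi> (Suc i) \<in> verts G - {r}" using i \<phi>V \<phi>0 by auto
    qed
    have pos: "\<iota> v > 0" if "v \<in> verts G - {r}" for v using that \<phi>\<iota>[of v] \<phi>0 by (cases "\<iota> v") auto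
    show "(\<lambda>v. \<iota> v - 1) \<in> verts G - {r} \<rightarrow> {0..<n}"
      using pos \<phi>\<iota>(2) by fastforce
    show "\<iota> (\<phi> (Suc x)) - 1 = x" if "x \<in> {0..<n}" for x using that \<iota>\<phi> by simp
    show "\<phi> (Suc (\<iota> y - 1)) = y" if "y \<in> verts G - {r}" for y using that pos[OF that] \<phi>\<iota>(1) by simp
  qed
  define t :: "nat \<Rightarrow> 'e \<Rightarrow> nat \<Rightarrow> 'a" where
    "t i e j = (if i = j then 1 else 0) - (if head G e = \<phi> (Suc j) then 1 else 0)" for i e j
  let ?L = "mat n n (\<lambda>(i, j). \<Sum>e \<in> out_arcs G (\<phi> (Suc i)). t i e j)"
  let ?M = "\<lambda>F. mat n n (\<lambda>(i, j). t i (F (\<phi> (Suc i))) j)"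
  have expand: "(\<Prod>i = 0..<n. \<Sum>e \<in> out_arcs G (\<phi> (Suc i)). t i e (p i)) =
      (\<Sum>F\<in>parent_maps. \<Prod>i = 0..<n. t i (F (\<phi> (Suc i))) (p i))" for p
  proof -
    let ?h = "\<lambda>v e. t (\<iota> v - 1) e (p (\<iota> v - 1))"
    have "(\<Prod>i = 0..<n. \<Sum>e \<in> out_arcs G (\<phi> (Suc i)). t i e (p i)) =
        (\<Prod>i = 0..<n. \<Sum>e \<in> out_arcs G (\<phi> (Suc i)). ?h (\<phi> (Suc i)) e)"
      by (intro prod.cong) (auto simp: \<iota>\<phi>)
    also have "\<dots> = (\<Prod>v \<in> verts G - {r}. \<Sum>e \<in> out_arcs G v. ?h v e)"
      by (rule prod.reindex_bij_betw[OF \<psi>])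
    also have "\<dots> = (\<Sum>F\<in>parent_maps. \<Prod>v \<in> verts G - {r}. ?h v (F v))"
      unfolding parent_maps_def by (rule prod_sum_PiE) auto
    also have "\<dots> = (\<Sum>F\<in>parent_maps. \<Prod>i = 0..<n. ?h (\<phi> (Suc i)) (F (\<phi> (Suc i))))"
      by (intro sum.cong refl) (rule prod.reindex_bij_betw[OF \<psi>, symmetric])
    also have "\<dots> = (\<Sum>F\<in>parent_maps. \<Prod>i = 0..<n. t i (F (\<phi> (Suc i))) (p i))"
      by (intro sum.cong prod.cong) (auto simp: \<iota>\<phi>)
    finally show ?thesis .
  qed
  have "det ?L = (\<Sum>p | p permutes {0..<n}. signof p * (\<Prod>i = 0..<n. \<Sum>e \<in> out_arcs G (\<phi> (Suc i)). t i e (p i)))"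
    by (subst det_def'[of _ n]) (auto intro!: sum.cong prod.cong simp: permutes_nat_less)
  also have "\<dots> = (\<Sum>F\<in>parent_maps. \<Sum>p | p permutes {0..<n}. signof p * (\<Prod>i = 0..<n. t i (F (\<phi> (Suc i))) (p i)))"
    unfolding expand sum_distrib_left by (rule sum.swap)
  also have "\<dots> = (\<Sum>F\<in>parent_maps. det (?M F))"
    by (intro sum.cong refl, subst det_def'[of _ n]) (auto intro!: sum.cong prod.cong simp: permutes_nat_less)
  also have "\<dots> = (\<Sum>F\<in>parent_maps. if F \<in> in_trees then 1 else 0)"
  proof (intro sum.cong refl)
    fix F assume F: "F \<in> parent_maps"
    define g where "g i = (if i = 0 then 0 else \<iota> (head G (F (\<phi> i))))" for i
    have arc: "F (\<phi> i) \<in> arcs G" if "i \<le> n" "i \<noteq> 0" for i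
    proof -
      have "\<phi> i \<noteq> r" using \<iota>\<phi>[OF that(1)] \<iota>\<phi>[of 0] that(2) \<phi>0 by auto
      then show ?thesis using parent_mapsD(1)[OF F \<phi>V[OF that(1)]] by blast
    qed
    have hV: "head G (F (\<phi> i)) \<in> verts G" if "i \<le> n" "i \<noteq> 0" for i
      using arc[OF that] by simp
    have g_le: "g i \<le> n" if "i \<le> n" for i using that hV \<phi>\<iota>(2) by (simp add: g_def)
    have conj: "(g ^^ k) i \<le> n \<and> \<phi> ((g ^^ k) i) = (parent F ^^ k) (\<phi> i)" if "i \<le> n" for i k
    proof (induction k)
      case 0
      then show ?case using that by simp
    next
      case (Suc k)
      let ?j = "(g ^^ k) i"
      have "\<phi> (g ?j) = parent F (\<phi> ?j)"
      proof (cases "?j = 0")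
        case True
        then show ?thesis by (simp add: g_def parent_def \<phi>0)
      next
        case False
        then have "\<phi> ?j \<noteq> r" using \<iota>\<phi>[of ?j] \<iota>\<phi>[of 0] Suc \<phi>0 by auto
        then have "parent F (\<phi> ?j) = head G (F (\<phi> ?j))" by (simp only: parent_def if_False)
        moreover have "\<phi> (g ?j) = head G (F (\<phi> ?j))"
        proof -
          have "g ?j = \<iota> (head G (F (\<phi> ?j)))" using False g_def[of ?j] by (simp only: if_False)
          moreover have "head G (F (\<phi> ?j)) \<in> verts G" using Suc False by (intro hV) blast+
          ultimately show ?thesis using \<phi>\<iota>(1) by (simp only:)
        qed
        ultimately show ?thesis by (simp only:)
      qed
      then show ?case using Suc g_le by simp
    qed
    have MF: "?M F = functional_laplacian n g"
      unfolding functional_laplacian_def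
    proof (rule cong_mat)
      fix i j assume ij: "i < n" "j < n"
      let ?u = "head G (F (\<phi> (Suc i)))"
      have gi: "g (Suc i) = \<iota> ?u" unfolding g_def by (simp only: nat.distinct if_False)
      have u: "\<phi> (\<iota> ?u) = ?u" using ij by (intro \<phi>\<iota>(1) hV) simp_all
      have j: "\<iota> (\<phi> (Suc j)) = Suc j" using ij by (intro \<iota>\<phi>) simp
      have "?u = \<phi> (Suc j) \<longleftrightarrow> g (Suc i) = Suc j"
        unfolding gi using u j by metis
      then show "(case (i, j) of (i, j) \<Rightarrow> t i (F (\<phi> (Suc i))) j) =
        (case (i, j) of (i, j) \<Rightarrow> (if i = j then 1 else 0) - (if g (Suc i) = Suc j then 1 else 0))"
        by (simp add: t_def)
    qed simp_all
    have zero: "(g ^^ k) i = 0 \<longleftrightarrow> (parent F ^^ k) (\<phi> i) = r" if "i \<le> n" for i k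
      using conj[OF that, of k] \<iota>\<phi>[of "(g ^^ k) i"] \<iota>\<phi>[of 0] \<phi>0 by auto
    show "det (?M F) = (if F \<in> in_trees then 1 else 0)"
    proof (cases "F \<in> in_trees")
      case True
      have "\<exists>k. (g ^^ k) i = 0" if "i \<le> n" for i
        using True \<phi>V[OF that] zero[OF that] by (auto simp: in_trees_def)
      then show ?thesis
        using True unfolding MF by (simp add: det_functional_laplacian_1)
    next
      case False
      then obtain v where v: "v \<in> verts G" "\<And>k. (parent F ^^ k) v \<noteq> r" using F by (auto simp: in_trees_def)
      have "(g ^^ k) (\<iota> v) \<noteq> 0" for k using zero[OF \<phi>\<iota>(2)[OF v(1)]] v \<phi>\<iota>(1) by auto
      then have "det (functional_laplacian n g :: 'a mat) = 0"
        using g_le \<phi>\<iota>(2)[OF v(1)] by (intro det_functional_laplacian_0[of g n "\<iota> v"]) (auto simp: g_def)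
      then show ?thesis using False unfolding MF by simp
    qed
  qed
  also have "\<dots> = of_nat (card in_trees)"
  proof -
    have "(\<Sum>F\<in>parent_maps. if F \<in> in_trees then 1 else (0::'a)) = (\<Sum>F\<in>in_trees. 1)"
      using finite_parent_maps by (intro sum.mono_neutral_cong_right) (auto simp: in_trees_def)
    then show ?thesis by simp
  qed
  finally show ?thesis by (simp only: t_def num_spanning_trees_eq)
qed

end

section \<open>Reduced Laplacians of Cayley graphs of cyclic groups\<close>

lemma vandermonde_det_nonzero:
  fixes r :: "nat \<Rightarrow> complex"
  assumes inj: "inj_on r {..<d}"
  shows "det (mat d d (\<lambda>(a, j). r a ^ j)) \<noteq> 0"
proof
  let ?V = "mat d d (\<lambda>(a, j). r a ^ j)"
  assume "det ?V = 0"
  then obtain v where v: "v \<in> carrier_vec d" "v \<noteq> 0\<^sub>v d" "?V *\<^sub>v v = 0\<^sub>v d"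
    using det_0_iff_vec_prod_zero[of ?V d] by auto
  define q where "q = (\<Sum>j<d. monom (v $ j) j)"
  have coeff_q: "coeff q j = (if j < d then v $ j else 0)" for j
    by (simp add: q_def coeff_sum)
  obtain j where "j < d" "v $ j \<noteq> 0" using v(1,2) by (metis carrier_vecD eq_vecI index_zero_vec)
  then have q0: "q \<noteq> 0" using coeff_q[of j] by auto
  have dpos: "d > 0" using \<open>j < d\<close> by simp
  have deg: "degree q < d" using coeff_q dpos by (intro degree_lessI) (auto simp: dpos)
  have root: "poly q (r a) = 0" if a: "a < d" for a
  proof -
    have "0 = (?V *\<^sub>v v) $ a" using v(3) a by simp
    also have "\<dots> = (\<Sum>j = 0..<d. r a ^ j * v $ j)"
      using a v(1) by (simp add: scalar_prod_def)
    also have "\<dots> = poly q (r a)"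
      by (simp add: q_def poly_sum poly_monom lessThan_atLeast0 mult.commute)
    finally show ?thesis by simp
  qed
  have "card (r ` {..<d}) \<le> card {x. poly q x = 0}"
    by (intro card_mono poly_roots_finite q0) (auto simp: root)
  also have "\<dots> \<le> degree q" by (rule card_poly_roots_bound[OF q0])
  finally show False using deg by (simp add: card_image[OF inj])
qed

text \<open>
  The hypothesis says that the rows of the Vandermonde matrix of \<open>r\<close> are left eigenvectors of \<open>C\<close>.
\<close>

lemma det_eq_prod_eigenvalues:
  fixes r w :: "nat \<Rightarrow> complex"
  assumes inj: "inj_on r {..<d}" and C: "C \<in> carrier_mat d d"
    and eig: "\<And>a j. a < d \<Longrightarrow> j < d \<Longrightarrow> (\<Sum>i<d. r a ^ i * C $$ (i, j)) = w a * r a ^ j"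
  shows "det C = (\<Prod>a<d. w a)"
proof -
  let ?V = "mat d d (\<lambda>(a, j). r a ^ j)" and ?D = "mat d d (\<lambda>(a, j). if a = j then w a else 0)"
  have "?V * C = ?D * ?V"
  proof (rule eq_matI)
    fix a j assume "a < dim_row (?D * ?V)" "j < dim_col (?D * ?V)"
    then have aj: "a < d" "j < d" by auto
    show "(?V * C) $$ (a, j) = (?D * ?V) $$ (a, j)"
    proof -
      have "(?D * ?V) $$ (a, j) = (\<Sum>i=0..<d. (if a = i then w a else 0) * r i ^ j)"
        using aj by (simp add: scalar_prod_def)
      also have "\<dots> = (\<Sum>i=0..<d. if a = i then w a * r a ^ j else 0)"
        by (intro sum.cong) auto
      also have "\<dots> = w a * r a ^ j" using aj by simp
      finally show ?thesis
        using C aj by (simp add: scalar_prod_def lessThan_atLeast0 flip: eig[OF aj])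
    qed
  qed (use C in auto)
  then have "det ?V * det C = det ?D * det ?V"
    using det_mult[OF _ C, of ?V] det_mult[of ?D d ?V] by auto
  moreover have "det ?D = (\<Prod>a<d. w a)"
    using det_upper_triangular[of ?D d]
    by (simp add: upper_triangular_def prod_list_diag_prod lessThan_atLeast0)
  ultimately show ?thesis using vandermonde_det_nonzero[OF inj] by simp
qed

lemma det_int_cong:
  fixes A B :: "int mat"
  assumes A: "A \<in> carrier_mat d d" and B: "B \<in> carrier_mat d d"
    and c: "\<And>i j. i < d \<Longrightarrow> j < d \<Longrightarrow> [A $$ (i, j) = B $$ (i, j)] (mod l)"
  shows "[det A = det B] (mod l)"
  unfolding det_def'[OF A] det_def'[OF B]
  by (intro cong_sum cong_mult cong_prod cong_refl c) (auto simp: permutes_nat_less)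

text \<open>
  Both the left upper and the right lower block of the matrix with blocks \<open>1, -u\<^sup>T, u, 1\<close> (\<open>u\<close> the
  all-ones vector) can serve as pivot; this gives the two sides.
\<close>

lemma det_id_plus_ones:
  "det (mat n n (\<lambda>(i, j). if i = j then 2 else 1) :: complex mat) = of_nat (Suc n)"
proof -
  let ?K = "mat n n (\<lambda>(i, j). if i = j then 2 else 1) :: complex mat"
  let ?u = "mat n 1 (\<lambda>_. 1) :: complex mat" and ?v = "mat 1 n (\<lambda>_. -1) :: complex mat"
  let ?s = "mat 1 1 (\<lambda>_. of_nat (Suc n)) :: complex mat"
  let ?E = "four_block_mat (1\<^sub>m 1) (0\<^sub>m 1 n) ?u (1\<^sub>m n)"
  let ?A = "four_block_mat (1\<^sub>m 1) ?v (0\<^sub>m n 1) ?K"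
  let ?B = "four_block_mat ?s ?v (0\<^sub>m n 1) (1\<^sub>m n)"
  have c: "?s \<in> carrier_mat 1 1" "?v \<in> carrier_mat 1 n" "?u \<in> carrier_mat n 1" "?K \<in> carrier_mat n n"
    "1\<^sub>m 1 \<in> carrier_mat 1 1" "1\<^sub>m n \<in> carrier_mat n n" "0\<^sub>m n 1 \<in> carrier_mat n 1" "0\<^sub>m 1 n \<in> carrier_mat 1 n"
    by auto
  have uK: "?u * ?v + ?K = 1\<^sub>m n"
    by (rule eq_matI) (auto simp: scalar_prod_def)
  have sv: "?s + ?v * ?u = 1\<^sub>m 1"
    by (rule eq_matI) (auto simp: scalar_prod_def)
  have "?E * ?A = four_block_mat (1\<^sub>m 1) ?v ?u (1\<^sub>m n)"
    unfolding mult_four_block_mat[OF c(5) c(8) c(3) c(6) c(5) c(2) c(7) c(4)]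
      left_mult_one_mat[OF c(2)] left_mult_one_mat[OF c(4)] right_mult_one_mat[OF c(3)]
      left_mult_one_mat[OF c(5)] left_mult_one_mat[OF c(7)] left_mult_zero_mat[OF c(7)] left_mult_zero_mat[OF c(4)]
      right_add_zero_mat[OF c(5)] right_add_zero_mat[OF c(2)] right_add_zero_mat[OF c(3)] uK
    by (rule refl)
  moreover have "?B * ?E = four_block_mat (1\<^sub>m 1) ?v ?u (1\<^sub>m n)"
    unfolding mult_four_block_mat[OF c(1) c(2) c(7) c(6) c(5) c(8) c(3) c(6)]
      right_mult_one_mat[OF c(1)] right_mult_one_mat[OF c(2)] right_mult_one_mat[OF c(6)] right_mult_one_mat[OF c(7)]
      left_mult_one_mat[OF c(3)] right_mult_zero_mat[OF c(1)] right_mult_zero_mat[OF c(7)]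
      left_add_zero_mat[OF c(2)] left_add_zero_mat[OF c(3)] left_add_zero_mat[OF c(6)] sv
    by (rule refl)
  ultimately have EAB: "?E * ?A = ?B * ?E" by simp
  have sq: "?E \<in> carrier_mat (1 + n) (1 + n)" "?A \<in> carrier_mat (1 + n) (1 + n)" "?B \<in> carrier_mat (1 + n) (1 + n)"
    by (rule four_block_carrier_mat; rule c)+
  have "det ?E * det ?A = det ?B * det ?E"
    using EAB det_mult[OF sq(1,2)] det_mult[OF sq(3,1)] by simp
  moreover have "det ?E = 1"
    using det_four_block_mat_upper_right_zero[OF c(5) refl c(3) c(6)] by simp
  moreover have "det ?A = det ?K"
    using det_four_block_mat_lower_left_zero[OF c(5) c(2) refl c(4)] by simp
  moreover have "det ?B = of_nat (Suc n)"
    using det_four_block_mat_lower_left_zero[OF c(1) c(2) refl c(6)] by (simp add: det_single)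
  ultimately show ?thesis by simp
qed

text \<open>
  Let \<open>V\<close> be the matrix of the nontrivial characters on the nonzero points, and \<open>W = V - 1\<close>
  (entrywise). Because the columns of \<open>L\<close> sum to zero, \<open>W L' = D V\<close> for the reduced matrix \<open>L'\<close> and the
  diagonal matrix \<open>D\<close> of the eigenvalues \<open>h\<close>. Because each nontrivial character sums to zero,
  \<open>W = V (I + J)\<close> for the identity \<open>I\<close> and the all-ones matrix \<open>J\<close>. Taking determinants
  gives the formula.
\<close>

lemma det_reduced_circulant:
  fixes L :: "nat \<Rightarrow> nat \<Rightarrow> complex" and r h :: "nat \<Rightarrow> complex"
  assumes inj: "inj_on r {..<n}"
    and root: "\<And>a. a < n \<Longrightarrow> r a ^ Suc n = 1" "\<And>a. a < n \<Longrightarrow> r a \<noteq> 1"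
    and col: "\<And>j. j < Suc n \<Longrightarrow> (\<Sum>i<Suc n. L i j) = 0"
    and eig: "\<And>a j. a < n \<Longrightarrow> j < Suc n \<Longrightarrow> (\<Sum>i<Suc n. r a ^ i * L i j) = h a * r a ^ j"
  shows "of_nat (Suc n) * det (mat n n (\<lambda>(i, j). L (Suc i) (Suc j))) = (\<Prod>a<n. h a)"
proof -
  let ?L = "mat n n (\<lambda>(i, j). L (Suc i) (Suc j))"
  let ?V = "mat n n (\<lambda>(a, j). r a ^ Suc j)" and ?M = "mat n n (\<lambda>(a, j). r a ^ j)"
  let ?K = "mat n n (\<lambda>(i, j). if i = j then 2 else 1) :: complex mat"
  let ?W = "mat n n (\<lambda>(a, j). r a ^ Suc j - 1)"
  let ?D = "\<lambda>h. mat n n (\<lambda>(a, j). if a = j then h a else 0) :: complex mat"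
  have diag: "det (?D g) = (\<Prod>a<n. g a)" for g :: "nat \<Rightarrow> complex"
    using det_upper_triangular[of "?D g" n]
    by (simp add: upper_triangular_def prod_list_diag_prod lessThan_atLeast0)
  have Dmult: "(\<Sum>i=0..<n. (if a = i then g a else 0) * F i) = g a * F a" if "a < n" for a g and F :: "nat \<Rightarrow> complex"
  proof -
    have "(\<Sum>i=0..<n. (if a = i then g a else 0) * F i) = (\<Sum>i=0..<n. if a = i then g a * F a else 0)"
      by (intro sum.cong) auto
    then show ?thesis using that by simp
  qed
  have "?V = ?D r * ?M"
  proof (rule eq_matI)
    fix a j assume "a < dim_row (?D r * ?M)" "j < dim_col (?D r * ?M)"
    then have aj: "a < n" "j < n" by auto
    have "(?D r * ?M) $$ (a, j) = (\<Sum>i=0..<n. (if a = i then r a else 0) * r i ^ j)"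
      using aj by (simp add: scalar_prod_def)
    also have "\<dots> = r a * r a ^ j" by (rule Dmult[OF aj(1)])
    finally show "?V $$ (a, j) = (?D r * ?M) $$ (a, j)" using aj by simp
  qed auto
  then have "det ?V = (\<Prod>a<n. r a) * det ?M"
    using det_mult[of "?D r" n ?M] by (simp add: diag)
  moreover have "r a \<noteq> 0" if "a < n" for a using root(1)[OF that] by auto
  ultimately have V: "det ?V \<noteq> 0" using vandermonde_det_nonzero[OF inj] by auto
  have "?V * ?K = ?W"
  proof (rule eq_matI)
    fix a j assume "a < dim_row ?W" "j < dim_col ?W"
    then have aj: "a < n" "j < n" by auto
    have "(?V * ?K) $$ (a, j) = (\<Sum>i<n. r a ^ Suc i * (if i = j then 2 else 1))"
      using aj by (simp add: scalar_prod_def lessThan_atLeast0)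
    also have "\<dots> = (\<Sum>i<n. r a ^ Suc i + (if i = j then r a ^ Suc j else 0))"
      by (intro sum.cong) auto
    also have "\<dots> = (\<Sum>i<n. r a ^ Suc i) + r a ^ Suc j"
      using aj by (simp add: sum.distrib del: power_Suc)
    also have "(\<Sum>i<n. r a ^ Suc i) = (\<Sum>i<Suc n. r a ^ i) - 1"
      by (simp only: sum.lessThan_Suc_shift) simp
    also have "(\<Sum>i<Suc n. r a ^ i) = 0"
      using root[OF aj(1)] geometric_sum[of "r a" "Suc n"] by (simp del: power_Suc)
    finally show "(?V * ?K) $$ (a, j) = ?W $$ (a, j)" using aj by simp
  qed auto
  moreover have "?W * ?L = ?D h * ?V"
  proof (rule eq_matI)
    fix a j assume "a < dim_row (?D h * ?V)" "j < dim_col (?D h * ?V)"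
    then have aj: "a < n" "j < n" by auto
    have "(?W * ?L) $$ (a, j) = (\<Sum>i<n. (r a ^ Suc i - 1) * L (Suc i) (Suc j))"
      using aj by (simp add: scalar_prod_def lessThan_atLeast0)
    also have "\<dots> = (\<Sum>i<Suc n. (r a ^ i - 1) * L i (Suc j))"
      by (simp only: sum.lessThan_Suc_shift) simp
    also have "\<dots> = (\<Sum>i<Suc n. r a ^ i * L i (Suc j)) - (\<Sum>i<Suc n. L i (Suc j))"
      by (simp only: left_diff_distrib sum_subtractf mult_1)
    also have "\<dots> = h a * r a ^ Suc j"
      using aj by (simp only: eig col Suc_less_eq) simp
    also have "\<dots> = (\<Sum>i=0..<n. (if a = i then h a else 0) * r i ^ Suc j)"
      by (rule Dmult[OF aj(1), symmetric])
    also have "\<dots> = (?D h * ?V) $$ (a, j)"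
      using aj by (simp add: scalar_prod_def del: power_Suc)
    finally show "(?W * ?L) $$ (a, j) = (?D h * ?V) $$ (a, j)" .
  qed auto
  ultimately have "det ?V * det ?K * det ?L = (\<Prod>a<n. h a) * det ?V"
    using det_mult[of ?V n ?K] det_mult[of ?W n ?L] det_mult[of "?D h" n ?V] by (simp add: diag)
  then show ?thesis using V by (simp add: det_id_plus_ones del: of_nat_Suc)
qed

lemma bij_betw_add_mod:
  assumes "q > 0"
  shows "bij_betw (\<lambda>i. (i + a) mod q) {..<q} {..<q::nat}"
proof -
  have "inj_on (\<lambda>i. (i + a) mod q) {..<q}"
  proof (rule inj_onI)
    fix x y assume "x \<in> {..<q}" "y \<in> {..<q}" "(x + a) mod q = (y + a) mod q"
    then show "x = y" by (metis cong_add_rcancel_nat cong_def cong_less_imp_eq_nat lessThan_iff zero_le)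
  qed
  moreover have "(\<lambda>i. (i + a) mod q) ` {..<q} \<subseteq> {..<q}" using assms by auto
  ultimately show ?thesis by (simp add: bij_betw_def endo_inj_surj)
qed

lemma root_power_mod: "z ^ q = 1 \<Longrightarrow> z ^ (n mod q) = (z ^ n :: 'a :: monoid_mult)"
  by (metis div_mult_mod_eq mult.left_neutral mult.commute power_add power_mult power_one)

lemma sum_shift_indicator:
  fixes z :: complex
  assumes q: "q > 0" and z: "z ^ q = 1" and j: "j < q"
  shows "(\<Sum>i<q. z ^ i * (if (i + a) mod q = j then 1 else 0)) = z ^ j * inverse (z ^ a)"
proof -
  have z0: "z \<noteq> 0" using z q by (metis power_eq_0_iff zero_neq_one power_0_left not_gr_zero)
  have "(\<Sum>i<q. z ^ i * (if (i + a) mod q = j then 1 else 0)) =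
        (\<Sum>i<q. (\<lambda>k. if k = j then z ^ j * inverse (z ^ a) else 0) ((i + a) mod q))"
  proof (intro sum.cong refl)
    fix i
    have "z ^ i * z ^ a = z ^ ((i + a) mod q)" by (simp only: root_power_mod[OF z] power_add)
    then show "z ^ i * (if (i + a) mod q = j then 1 else 0) =
      (\<lambda>k. if k = j then z ^ j * inverse (z ^ a) else 0) ((i + a) mod q)"
      using z0 by (auto simp: field_simps)
  qed
  also have "\<dots> = (\<Sum>k<q. if k = j then z ^ j * inverse (z ^ a) else 0)"
    by (rule sum.reindex_bij_betw[OF bij_betw_add_mod[OF q]])
  also have "\<dots> = z ^ j * inverse (z ^ a)" using j by simp
  finally show ?thesis .
qed

text \<open>
  Here \<open>L\<close> is the Laplacian of the graph on \<open>\<int>/q\<close> with an arc from \<open>i\<close> to \<open>i + a e\<close> for all \<open>i\<close> and \<open>e\<close>. Its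
  left eigenvectors are the characters \<open>i \<mapsto> z^i\<close>; the trivial one has eigenvalue 0, and the others
  account for the product.
\<close>

lemma det_reduced_cayley_laplacian:
  fixes a :: "'e \<Rightarrow> nat" and E :: "'e set"
  assumes q: "q > 0"
  defines "L \<equiv> \<lambda>i j. \<Sum>e\<in>E. (if i = j then 1 else 0) - (if (i + a e) mod q = j then 1 else 0 :: complex)"
  shows "of_nat q * det (mat (q - 1) (q - 1) (\<lambda>(i, j). L (Suc i) (Suc j))) =
    (\<Prod>z | z ^ q = 1 \<and> z \<noteq> 1. \<Sum>e\<in>E. 1 - inverse (z ^ a e))"
proof -
  let ?R = "{z::complex. z ^ q = 1 \<and> z \<noteq> 1}"
  obtain n where n: "q = Suc n" using q by (cases q) auto
  have Rd: "?R = {z. z ^ q = 1} - {1}" by auto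
  have fin: "finite ?R" unfolding Rd using q by (intro finite_Diff finite_roots_unity) simp
  have "card {z::complex. z ^ q = 1} = q" using q by (intro card_roots_unity_eq) simp
  then have "card ?R = n" unfolding Rd using n by (subst card_Diff_singleton) simp_all
  then obtain r where r: "bij_betw r {..<n} ?R"
    using ex_bij_betw_nat_finite[OF fin] unfolding atLeast0LessThan by blast
  have rR: "r k ^ q = 1 \<and> r k \<noteq> 1" if "k < n" for k
    using bij_betwE[OF r] that by blast
  have eig: "(\<Sum>i<q. z ^ i * L i j) = (\<Sum>e\<in>E. 1 - inverse (z ^ a e)) * z ^ j"
    if "z ^ q = 1" "j < q" for z j
  proof -
    have 1: "(\<Sum>i<q. z ^ i * (if i = j then 1 else 0)) = z ^ j"
    proof -
      have "(\<Sum>i<q. z ^ i * (if i = j then 1 else 0)) = (\<Sum>i<q. if i = j then z ^ j else 0)"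
        by (intro sum.cong) auto
      then show ?thesis using that by simp
    qed
    have "(\<Sum>i<q. z ^ i * L i j) = (\<Sum>i<q. \<Sum>e\<in>E. z ^ i * (if i = j then 1 else 0) -
        z ^ i * (if (i + a e) mod q = j then 1 else 0))"
      unfolding L_def by (simp only: sum_distrib_left right_diff_distrib)
    also have "\<dots> = (\<Sum>e\<in>E. \<Sum>i<q. z ^ i * (if i = j then 1 else 0) -
        z ^ i * (if (i + a e) mod q = j then 1 else 0))"
      by (rule sum.swap)
    also have "\<dots> = (\<Sum>e\<in>E. z ^ j - z ^ j * inverse (z ^ a e))"
      by (simp only: sum_subtractf 1 sum_shift_indicator[OF q that])
    also have "\<dots> = (\<Sum>e\<in>E. 1 - inverse (z ^ a e)) * z ^ j"
      unfolding sum_distrib_right by (intro sum.cong) (auto simp: algebra_simps)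
    finally show ?thesis .
  qed
  have col: "(\<Sum>i<q. L i j) = 0" if "j < q" for j
    using eig[OF _ that, of 1] by simp
  have "of_nat (Suc n) * det (mat n n (\<lambda>(i, j). L (Suc i) (Suc j))) =
      (\<Prod>k<n. \<Sum>e\<in>E. 1 - inverse (r k ^ a e))"
  proof (rule det_reduced_circulant)
    show "inj_on r {..<n}" using r by (rule bij_betw_imp_inj_on)
    show "r k ^ Suc n = 1" "r k \<noteq> 1" if "k < n" for k using rR[OF that] unfolding n by blast+
    show "(\<Sum>i<Suc n. L i j) = 0" if "j < Suc n" for j using col that unfolding n by blast
    show "(\<Sum>i<Suc n. r k ^ i * L i j) = (\<Sum>e\<in>E. 1 - inverse (r k ^ a e)) * r k ^ j"
      if "k < n" "j < Suc n" for k j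
      using eig[of "r k" j] rR[of k] that unfolding n by blast
  qed
  also have "\<dots> = (\<Prod>z\<in>?R. \<Sum>e\<in>E. 1 - inverse (z ^ a e))"
    by (rule prod.reindex_bij_betw[OF r])
  finally show ?thesis unfolding n by (simp only: diff_Suc_1)
qed

section \<open>Norms of integer polynomials\<close>

definition ev :: "int poly \<Rightarrow> complex \<Rightarrow> complex" where
  "ev s z = poly (map_poly of_int s) z"

lemma ev_altdef: "ev s z = (\<Sum>i\<le>degree s. of_int (coeff s i) * z ^ i)"
  by (simp add: ev_def poly_altdef degree_map_poly coeff_map_poly)

lemma ev_add [simp]: "ev (s + t) z = ev s z + ev t z"
  and ev_mult [simp]: "ev (s * t) z = ev s z * ev t z"
  and ev_diff [simp]: "ev (s - t) z = ev s z - ev t z"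
  and ev_minus [simp]: "ev (- s) z = - ev s z"
  by (simp_all add: ev_def hom_distribs)

lemma ev_0 [simp]: "ev 0 z = 0"
  and ev_pCons: "ev (pCons a s) z = of_int a + z * ev s z"
  by (simp_all add: ev_def of_int_hom.map_poly_pCons_hom)

lemma ev_1 [simp]: "ev 1 z = 1"
  and ev_const [simp]: "ev [:a:] z = of_int a"
  by (simp_all add: ev_pCons one_pCons)

lemma ev_monom [simp]: "ev (monom a n) z = of_int a * z ^ n"
  by (simp add: ev_def poly_monom)

lemma ev_smult [simp]: "ev (Polynomial.smult a s) z = of_int a * ev s z"
  using ev_mult[of "[:a:]" s z] by simp

lemma ev_power [simp]: "ev (s ^ n) z = ev s z ^ n"
  by (induction n) auto

lemma ev_sum [simp]: "ev (\<Sum>i\<in>I. s i) z = (\<Sum>i\<in>I. ev (s i) z)"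
  by (induction I rule: infinite_finite_induct) auto

text \<open>
  A set of complex numbers that is the full set of roots of a monic separable integer polynomial
  \<open>f\<close>. The product of the values of an integer polynomial over such a set is its norm from
  \<open>\<int>[T]/(f)\<close> to \<open>\<int>\<close>.
\<close>

locale monic_root_set =
  fixes f :: "int poly" and P :: "complex set"
  assumes monic: "lead_coeff f = 1" and fin: "finite P"
    and deg: "degree f = card P" and root: "\<And>z. z \<in> P \<Longrightarrow> ev f z = 0"
begin

text \<open>
  \<open>C s\<close> is the matrix of the multiplication by \<open>s\<close> on \<open>\<int>[T]/(f)\<close> in the basis of the powers of \<open>T\<close>.
  Evaluation at the roots of \<open>f\<close> diagonalises it.
\<close>

lemma root_norm_matrix:
  obtains r C where "bij_betw r {..<card P} P" "\<And>s. C s \<in> carrier_mat (card P) (card P)"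
    "\<And>s a j. a < card P \<Longrightarrow> j < card P \<Longrightarrow>
        (\<Sum>i<card P. r a ^ i * of_int (C s $$ (i, j))) = ev s (r a) * r a ^ j"
proof -
  let ?d = "card P"
  obtain r where r: "bij_betw r {..<?d} P"
    using fin by (metis ex_bij_betw_nat_finite lessThan_atLeast0)
  define C where "C s = mat ?d ?d (\<lambda>(i, j). coeff (pseudo_mod (s * monom 1 j) f) i)" for s
  have "(\<Sum>i<?d. r a ^ i * of_int (C s $$ (i, j))) = ev s (r a) * r a ^ j"
    if aj: "a < ?d" "j < ?d" for s a j
  proof -
    let ?z = "r a" and ?g = "s * monom 1 j"
    let ?m = "pseudo_mod ?g f"
    have z: "?z \<in> P" using r aj by (auto simp: bij_betw_def)
    have f0: "f \<noteq> 0" using monic by auto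
    obtain q where "pseudo_divmod ?g f = (q, ?m)"
      by (metis pseudo_mod_def prod.collapse)
    from pseudo_divmod(1)[OF f0 this] have "?g = f * q + ?m" using monic by simp
    then have "ev ?g ?z = ev f ?z * ev q ?z + ev ?m ?z" by (metis ev_add ev_mult)
    then have 1: "ev ?m ?z = ev s ?z * ?z ^ j" using root[OF z] by simp
    have "?m = 0 \<or> degree ?m < ?d" using pseudo_mod(2)[OF f0, of ?g] deg by simp
    then have "degree ?m < ?d" using aj by auto
    then have "ev ?m ?z = (\<Sum>i<?d. of_int (coeff ?m i) * ?z ^ i)"
      unfolding ev_altdef by (intro sum.mono_neutral_left) (auto simp: coeff_eq_0)
    then show ?thesis using 1 aj by (simp add: C_def mult.commute)
  qed
  then show ?thesis using that[OF r, of C] by (auto simp: C_def)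
qed

text \<open>
  Norms are determinants of integer matrices. Congruent elements have
  congruent matrices, hence congruent norms. The congruence of the elements is only required after
  evaluation at the roots, that is, in \<open>\<int>[T]/(f)\<close>.
\<close>

lemma root_norm_cong_exists:
  assumes "\<And>z. z \<in> P \<Longrightarrow> ev s z = ev t z + of_int l * ev c z"
  shows "\<exists>a b. of_int a = (\<Prod>z\<in>P. ev s z) \<and> of_int b = (\<Prod>z\<in>P. ev t z) \<and> [a = b] (mod l)"
proof -
  obtain r C where r: "bij_betw r {..<card P} P" and C: "\<And>s. C s \<in> carrier_mat (card P) (card P)"
    and eig: "\<And>s a j. a < card P \<Longrightarrow> j < card P \<Longrightarrow>
        (\<Sum>i<card P. r a ^ i * of_int (C s $$ (i, j))) = ev s (r a) * r a ^ j"
    using root_norm_matrix by blast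
  have inj: "inj_on r {..<card P}" using r by (auto simp: bij_betw_def)
  have rP: "r a \<in> P" if "a < card P" for a using r that by (auto simp: bij_betw_def)
  have prod: "(\<Prod>a<card P. ev u (r a)) = (\<Prod>z\<in>P. ev u z)" for u
    by (rule prod.reindex_bij_betw[OF r])
  define S where "S = C t + l \<cdot>\<^sub>m C c"
  have S: "S \<in> carrier_mat (card P) (card P)" using C by (simp add: S_def)
  have Sij: "S $$ (i, j) = C t $$ (i, j) + l * C c $$ (i, j)" if "i < card P" "j < card P" for i j
    using that C[of t] C[of c] by (simp add: S_def)
  have "of_int (det S) = det (map_mat complex_of_int S)" by simp
  also have "\<dots> = (\<Prod>a<card P. ev s (r a))"
  proof (rule det_eq_prod_eigenvalues[OF inj])
    fix a j assume aj: "a < card P" "j < card P"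
    have "(\<Sum>i<card P. r a ^ i * map_mat complex_of_int S $$ (i, j)) =
      (\<Sum>i<card P. r a ^ i * of_int (C t $$ (i, j)) + of_int l * (r a ^ i * of_int (C c $$ (i, j))))"
      using S aj by (intro sum.cong) (auto simp: Sij algebra_simps)
    also have "\<dots> = ev t (r a) * r a ^ j + of_int l * (ev c (r a) * r a ^ j)"
      by (simp add: sum.distrib eig aj flip: sum_distrib_left)
    also have "\<dots> = ev s (r a) * r a ^ j" using assms[OF rP] aj by (simp add: algebra_simps)
    finally show "(\<Sum>i<card P. r a ^ i * map_mat complex_of_int S $$ (i, j)) = ev s (r a) * r a ^ j" .
  qed (use S in auto)
  finally have 1: "of_int (det S) = (\<Prod>z\<in>P. ev s z)" by (simp add: prod)
  have "of_int (det (C t)) = det (map_mat complex_of_int (C t))" by simp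
  also have "\<dots> = (\<Prod>a<card P. ev t (r a))"
    using C[of t] eig by (intro det_eq_prod_eigenvalues[OF inj]) auto
  finally have 2: "of_int (det (C t)) = (\<Prod>z\<in>P. ev t z)" by (simp add: prod)
  have "[det S = det (C t)] (mod l)"
    by (rule det_int_cong[OF S C]) (simp add: Sij cong_def)
  with 1 2 show ?thesis by blast
qed

definition root_norm :: "int poly \<Rightarrow> int" where
  "root_norm s = (THE a. of_int a = (\<Prod>z\<in>P. ev s z))"

lemma of_int_root_norm: "of_int (root_norm s) = (\<Prod>z\<in>P. ev s z)"
proof -
  obtain a where a: "of_int a = (\<Prod>z\<in>P. ev s z)"
    using root_norm_cong_exists[of s s 0 0] by auto
  then have "root_norm s = a" unfolding root_norm_def
    by (intro the_equality) (auto simp flip: of_int_eq_iff[where ?'a = complex])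
  then show ?thesis using a by simp
qed

lemma root_norm_eqI: "of_int a = (\<Prod>z\<in>P. ev s z) \<Longrightarrow> root_norm s = a"
  by (metis of_int_eq_iff of_int_root_norm)

lemma root_norm_cong:
  assumes "\<And>z. z \<in> P \<Longrightarrow> ev s z = ev t z + of_int l * ev c z"
  shows "[root_norm s = root_norm t] (mod l)"
  using root_norm_cong_exists[OF assms] root_norm_eqI by metis

lemma root_norm_cong_0:
  assumes "\<And>z. z \<in> P \<Longrightarrow> ev s z = ev t z"
  shows "root_norm s = root_norm t"
  by (intro root_norm_eqI) (simp add: of_int_root_norm assms)

lemma root_norm_mult: "root_norm (s * t) = root_norm s * root_norm t"
  by (intro root_norm_eqI) (simp add: of_int_root_norm prod.distrib)

lemma root_norm_const: "root_norm [:a:] = a ^ card P"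
  by (intro root_norm_eqI) simp

lemma root_norm_power: "root_norm (s ^ n) = root_norm s ^ n"
  by (intro root_norm_eqI) (simp add: of_int_root_norm prod_power_distrib)

end

section \<open>Norms from the cyclotomic rings of \<open>p\<close>-power order\<close>

lemma ev_of_nat [simp]: "ev (of_nat n) z = of_nat n"
  by (subst of_nat_poly) simp

text \<open>
  The primitive \<open>p^(m+1)\<close>-th roots of unity, for a prime \<open>p\<close>.
\<close>

definition level_roots :: "nat \<Rightarrow> nat \<Rightarrow> complex set" where
  "level_roots p m = {z. z ^ p ^ Suc m = 1 \<and> z ^ p ^ m \<noteq> 1}"

text \<open>
  The cyclotomic polynomial of order \<open>p^(m+1)\<close>, for a prime \<open>p\<close>.
\<close>

definition level_poly :: "nat \<Rightarrow> nat \<Rightarrow> int poly" where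
  "level_poly p m = (\<Sum>i<p. monom 1 (i * p ^ m))"

lemma level_poly_mult: "level_poly p m * (monom 1 (p ^ m) - 1) = monom 1 (p ^ Suc m) - 1"
proof -
  have "monom 1 (i * p ^ m) = (monom 1 (p ^ m) :: int poly) ^ i" for i
    by (simp add: monom_power mult.commute)
  then have "level_poly p m = (\<Sum>i<p. monom 1 (p ^ m) ^ i)" by (simp add: level_poly_def)
  then have "level_poly p m * (monom 1 (p ^ m) - 1) = monom 1 (p ^ m) ^ p - 1"
    by (metis power_diff_1_eq mult.commute)
  also have "(monom 1 (p ^ m) :: int poly) ^ p = monom 1 (p ^ Suc m)"
    by (simp add: monom_power mult.commute)
  finally show ?thesis .
qed

lemma card_level_roots:
  assumes "p \<ge> 2"
  shows "card (level_roots p m) = (p - 1) * p ^ m" "finite (level_roots p m)"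
proof -
  have eq: "level_roots p m = {z. z ^ p ^ Suc m = 1} - {z. z ^ p ^ m = 1}"
    by (auto simp: level_roots_def)
  have fin: "finite {z::complex. z ^ p ^ k = 1}" for k
    using assms by (intro finite_roots_unity) (simp add: Suc_le_eq)
  have sub: "{z::complex. z ^ p ^ m = 1} \<subseteq> {z. z ^ p ^ Suc m = 1}"
    by (auto simp: power_mult mult.commute[of p])
  show "finite (level_roots p m)" unfolding eq using fin by blast
  show "card (level_roots p m) = (p - 1) * p ^ m"
    unfolding eq card_Diff_subset[OF fin sub] using assms
    by (simp add: card_roots_unity_eq diff_mult_distrib del: power_Suc) simp
qed

lemma monic_root_set_level:
  assumes p: "p \<ge> 2"
  shows "monic_root_set (level_poly p m) (level_roots p m)"
proof
  have c: "coeff (level_poly p m) n = (\<Sum>i<p. if i * p ^ m = n then 1 else 0)" for n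
    by (simp add: level_poly_def coeff_sum)
  have c1: "coeff (level_poly p m) ((p - 1) * p ^ m) = 1"
  proof -
    have "coeff (level_poly p m) ((p - 1) * p ^ m) = (\<Sum>i<p. if i = p - 1 then 1 else 0)"
      unfolding c using p by (intro sum.cong) auto
    then show ?thesis using p by simp
  qed
  have "degree (level_poly p m) \<le> (p - 1) * p ^ m"
    unfolding level_poly_def
    by (intro degree_sum_le order.trans[OF degree_monom_le] mult_right_mono) auto
  moreover have "degree (level_poly p m) \<ge> (p - 1) * p ^ m"
    using c1 by (intro le_degree) auto
  ultimately have d: "degree (level_poly p m) = (p - 1) * p ^ m" by simp
  show "lead_coeff (level_poly p m) = 1" by (simp only: d c1)
  show "finite (level_roots p m)" "degree (level_poly p m) = card (level_roots p m)"
    by (simp_all add: card_level_roots p d)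
  fix z assume z: "z \<in> level_roots p m"
  have "ev (level_poly p m) z * (z ^ p ^ m - 1) = z ^ p ^ Suc m - 1"
    using arg_cong[OF level_poly_mult[of p m], of "\<lambda>s. ev s z"] by simp
  also have "\<dots> = 0" using z by (simp add: level_roots_def)
  finally show "ev (level_poly p m) z = 0" using z by (simp add: level_roots_def)
qed

lemma prime_dvd_power_add:
  fixes x y :: "'a::comm_ring_1"
  assumes "prime p"
  shows "of_nat p dvd (x + y) ^ p - (x ^ p + y ^ p)"
proof -
  let ?t = "\<lambda>k. of_nat (p choose k) * x ^ k * y ^ (p - k)"
  have p: "p > 1" using assms prime_gt_1_nat by blast
  have "{..p} = insert 0 (insert p {1..<p})" using p by auto
  then have "(x + y) ^ p = y ^ p + (x ^ p + (\<Sum>k=1..<p. ?t k))"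
    using p by (simp add: binomial_ring)
  then have "(x + y) ^ p - (x ^ p + y ^ p) = (\<Sum>k=1..<p. ?t k)" by simp
  also have "of_nat p dvd \<dots>"
  proof (intro dvd_sum dvd_mult2)
    fix k assume k: "k \<in> {1..<p}"
    then have "p dvd p choose k" using assms by (intro dvd_choose_prime) (auto dest: prime_gt_0_nat)
    then show "(of_nat p :: 'a) dvd of_nat (p choose k)" by (auto simp: dvd_def)
  qed
  finally show ?thesis .
qed

lemma dvd_diff_power:
  fixes a b d :: "'a::comm_ring_1"
  assumes "d dvd a - b" shows "d dvd a ^ n - b ^ n"
  unfolding power_diff_sumr2 using assms by (rule dvd_mult2)

abbreviation "X_minus_one \<equiv> [:-1, 1::int:]"

lemma X_minus_1_power_p_power:
  assumes p: "prime p"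
  shows "of_nat p dvd X_minus_one ^ p ^ m - (monom 1 (p ^ m) - 1)"
proof (induction m)
  case 0
  then show ?case by (simp add: monom_altdef one_pCons)
next
  case (Suc m)
  let ?x = "monom 1 (p ^ m) - 1 :: int poly"
  have "of_nat p dvd (X_minus_one ^ p ^ m) ^ p - ?x ^ p" by (rule dvd_diff_power[OF Suc])
  moreover have "of_nat p dvd (?x + 1) ^ p - (?x ^ p + 1 ^ p)" by (rule prime_dvd_power_add[OF p])
  then have "of_nat p dvd monom 1 (p ^ Suc m) - (?x ^ p + 1)"
    by (simp add: monom_power mult.commute)
  ultimately have "of_nat p dvd ((X_minus_one ^ p ^ m) ^ p - ?x ^ p) - (monom 1 (p ^ Suc m) - (?x ^ p + 1))"
    by (rule dvd_diff)
  also have "\<dots> = X_minus_one ^ p ^ Suc m - (monom 1 (p ^ Suc m) - 1)"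
    by (simp add: algebra_simps flip: power_mult)
  finally show ?case .
qed

text \<open>
  The cyclotomic polynomial is totally ramified at \<open>p\<close>: it is congruent to a power of \<open>T - 1\<close>. The
  value of the cofactor at 1 is 1 because the cyclotomic polynomial takes the value \<open>p\<close> there; it
  makes the cofactor a unit at \<open>p\<close>.
\<close>

lemma level_poly_mod_p:
  assumes p: "prime p"
  obtains c where "level_poly p m = X_minus_one ^ ((p - 1) * p ^ m) + of_nat p * c" "poly c 1 = 1"
proof -
  let ?\<phi> = "(p - 1) * p ^ m" and ?q = "p ^ m" and ?f = "level_poly p m"
  have p0: "p > 1" using p prime_gt_1_nat by blast
  have prm: "prime_elem (of_nat p :: int poly)"
    using p by (simp add: of_nat_poly prime_elem_const_poly_iff)
  have exp: "?q + ?\<phi> = p ^ Suc m" using p0 by (simp add: algebra_simps)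
  have "of_nat p dvd X_minus_one ^ ?q - (monom 1 ?q - 1)"
       "of_nat p dvd X_minus_one ^ p ^ Suc m - (monom 1 (p ^ Suc m) - 1)"
    by (rule X_minus_1_power_p_power[OF p])+
  then have "of_nat p dvd ?f * (X_minus_one ^ ?q - (monom 1 ?q - 1)) - (X_minus_one ^ p ^ Suc m - (monom 1 (p ^ Suc m) - 1))"
    by (rule dvd_diff[OF dvd_mult])
  also have "\<dots> = X_minus_one ^ ?q * (?f - X_minus_one ^ ?\<phi>)"
  proof -
    have Y: "X_minus_one ^ p ^ Suc m = X_minus_one ^ ?q * X_minus_one ^ ?\<phi>" by (simp only: exp flip: power_add)
    show ?thesis unfolding Y level_poly_mult[symmetric] by (simp only: algebra_simps)
  qed
  finally have "of_nat p dvd X_minus_one ^ ?q \<or> of_nat p dvd ?f - X_minus_one ^ ?\<phi>"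
    using prm prime_elem_dvd_mult_iff by blast
  moreover have "\<not> of_nat p dvd X_minus_one ^ ?q"
  proof
    assume "of_nat p dvd X_minus_one ^ ?q"
    then have "of_nat p dvd X_minus_one" using prm prime_elem_dvd_power by blast
    then have "int p dvd coeff X_minus_one 1" by (metis const_poly_dvd_iff of_nat_poly)
    then show False using p0 by simp
  qed
  ultimately obtain c where c: "?f - X_minus_one ^ ?\<phi> = of_nat p * c" by (auto elim: dvdE)
  have "poly ?f 1 = int p" by (simp add: level_poly_def poly_sum poly_monom)
  then have "int p * poly c 1 = int p"
    using arg_cong[OF c, of "\<lambda>s. poly s 1"] p0 by (simp add: of_nat_poly power_0_left)
  then have "poly c 1 = 1" using p0 by simp
  with c show ?thesis by (intro that[of c]) (auto simp: algebra_simps)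
qed

locale p_power_level =
  fixes p m :: nat assumes p: "prime p"

sublocale p_power_level \<subseteq> monic_root_set "level_poly p m" "level_roots p m"
  by (rule monic_root_set_level) (use p prime_ge_2_nat in blast)

context p_power_level begin

text \<open>
  The ring \<open>\<int>[z]\<close> has a single prime above \<open>p\<close>, generated by \<open>z - 1\<close>, so that an element \<open>s(z)\<close> with
  \<open>s(1) = \<plusminus>1\<close> is a unit at \<open>p\<close>. Concretely, \<open>z - 1\<close> is nilpotent modulo \<open>p\<close>, and a finite
  geometric series inverts \<open>s(z)\<close> modulo \<open>p\<close>.
\<close>

lemma root_norm_coprime_p:
  assumes s: "\<bar>poly s 1\<bar> = 1"
  shows "\<not> int p dvd root_norm s"
proof
  assume dvd: "int p dvd root_norm s"
  define N where "N = p ^ Suc m"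
  define e where "e = poly s 1"
  have "poly (s - [:e:]) 1 = 0" by (simp add: e_def)
  then have "X_minus_one dvd s - [:e:]" using poly_eq_0_iff_dvd[of "s - [:e:]" 1] by simp
  then obtain v where v: "s - [:e:] = X_minus_one * v" by (elim dvdE)
  (* s = e - b with e = s(1) a unit and b nilpotent modulo p at the roots; t is the geometric series. *)
  define b where "b = - (X_minus_one * v)"
  have sb: "s = [:e:] - b" using v by (simp add: b_def algebra_simps)
  define t where "t = (\<Sum>i<N. b ^ (N - Suc i) * [:e:] ^ i)"
  have "[:e:] ^ N - b ^ N = ([:e:] - b) * t" unfolding t_def by (rule power_diff_sumr2)
  then have st: "s * t = [:e ^ N:] - b ^ N" using sb by (simp add: poly_const_pow)
  obtain c where "X_minus_one ^ N - (monom 1 N - 1) = of_nat p * c"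
    using X_minus_1_power_p_power[OF p, of "Suc m"] unfolding N_def by (auto elim: dvdE)
  then have c: "X_minus_one ^ N = monom 1 N - 1 + of_nat p * c" by (simp add: algebra_simps)
  have "[root_norm (s * t) = root_norm [:e ^ N:]] (mod int p)"
  proof (rule root_norm_cong)
    fix z assume "z \<in> level_roots p m"
    then have "z ^ N = 1" by (simp add: level_roots_def N_def)
    then have 1: "ev (X_minus_one ^ N) z = of_nat p * ev c z" unfolding c by simp
    have "ev (b ^ N) z = (-1) ^ N * ev (X_minus_one ^ N) z * ev v z ^ N"
      by (simp only: b_def ev_power ev_minus ev_mult ev_1 power_minus[of "_ * _"] power_mult_distrib mult.assoc)
    then show "ev (s * t) z = ev [:e ^ N:] z + of_int (int p) * ev (- ((-1) ^ N) * c * v ^ N) z"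
      unfolding st ev_diff 1 by (simp only: ev_mult ev_minus ev_power ev_1 of_int_of_nat_eq) (simp add: algebra_simps)
  qed
  moreover have "int p dvd root_norm (s * t)" using dvd by (simp add: root_norm_mult)
  ultimately have "int p dvd root_norm [:e ^ N:]" by (simp add: cong_dvd_iff)
  moreover have "\<bar>root_norm [:e ^ N:]\<bar> = 1" using s by (simp add: root_norm_const e_def power_abs)
  ultimately have "int p dvd 1" by (metis dvd_abs_iff)
  then show False using prime_gt_1_nat[OF p] by simp
qed

text \<open>
  Up to units at \<open>p\<close>, \<open>p\<close> is the power of \<open>z - 1\<close> whose exponent is the degree of \<open>z\<close>. Hence \<open>z - 1\<close>
  has norm of valuation 1, and the term \<open>p w(z)\<close> is divisible by a higher power of \<open>z - 1\<close> than the
  leading term \<open>\<plusminus>(z - 1)^r\<close> as long as \<open>r\<close> is smaller than that degree.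
\<close>

lemma multiplicity_root_norm_p:
  assumes G: "G = Polynomial.smult e (X_minus_one ^ r) + of_nat p * w" and e: "\<bar>e\<bar> = 1"
    and r: "r < (p - 1) * p ^ m"
  shows "multiplicity (int p) (root_norm G) = r"
proof -
  let ?\<phi> = "(p - 1) * p ^ m" and ?P = "level_roots p m"
  have p2: "p \<ge> 2" using p prime_ge_2_nat by blast
  have card: "card ?P = ?\<phi>" using card_level_roots(1)[OF p2] .
  have pi: "prime_elem (int p)" using p by simp
  obtain c where c: "level_poly p m = X_minus_one ^ ?\<phi> + of_nat p * c" "poly c 1 = 1"
    using level_poly_mod_p[OF p] by blast
  have rel: "of_nat p * ev c z = - (ev X_minus_one z ^ ?\<phi>)" if "z \<in> ?P" for z
  proof -
    have "0 = ev (level_poly p m) z" using root[OF that] by simp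
    also have "\<dots> = ev X_minus_one z ^ ?\<phi> + of_nat p * ev c z" unfolding c(1) by (simp del: ev_pCons)
    finally show ?thesis by (simp add: eq_neg_iff_add_eq_0 add.commute)
  qed
  have nc: "\<not> int p dvd root_norm c" by (rule root_norm_coprime_p) (simp add: c)
  then have nc0: "root_norm c \<noteq> 0" by auto
  have "root_norm ([:int p:] * c) = root_norm ([:-1:] * X_minus_one ^ ?\<phi>)"
    by (rule root_norm_cong_0) (simp add: rel del: ev_pCons)
  then have eq: "int p ^ ?\<phi> * root_norm c = (-1) ^ ?\<phi> * root_norm X_minus_one ^ ?\<phi>"
    by (simp only: root_norm_mult root_norm_const root_norm_power card)
  have pos: "?\<phi> > 0" using p2 by simp
  have "root_norm X_minus_one \<noteq> 0"
  proof
    assume "root_norm X_minus_one = 0"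
    then have "int p ^ ?\<phi> * root_norm c = 0" using eq pos by (simp add: power_0_left)
    then show False using nc0 p2 by simp
  qed
  note nX = this
  have "multiplicity (int p) (int p ^ ?\<phi> * root_norm c) = ?\<phi>"
    using nc nc0 pi p2 by (simp add: prime_elem_multiplicity_mult_distrib not_dvd_imp_multiplicity_0)
  moreover have "multiplicity (int p) ((-1) ^ ?\<phi> * root_norm X_minus_one ^ ?\<phi>) = ?\<phi> * multiplicity (int p) (root_norm X_minus_one)"
    using nX pi by (simp add: multiplicity_times_unit_right is_unit_power_iff prime_elem_multiplicity_power_distrib mult.commute)
  ultimately have mX: "multiplicity (int p) (root_norm X_minus_one) = 1" using eq pos by simp
  (* Multiplying G by the unit c turns p into a power of z - 1, which can be cancelled against (z - 1)^r. *)
  define s where "s = Polynomial.smult e c - X_minus_one ^ (?\<phi> - r) * w"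
  have "poly s 1 = e" using r by (simp add: s_def c power_0_left)
  then have ns: "\<not> int p dvd root_norm s" using e by (intro root_norm_coprime_p) simp
  then have ns0: "root_norm s \<noteq> 0" by auto
  have "root_norm (G * c) = root_norm (X_minus_one ^ r * s)"
  proof (rule root_norm_cong_0)
    fix z assume z: "z \<in> ?P"
    let ?x = "ev X_minus_one z"
    have "ev (G * c) z = of_int e * ?x ^ r * ev c z + (of_nat p * ev c z) * ev w z"
      unfolding G by (simp add: algebra_simps del: ev_pCons)
    also have "\<dots> = of_int e * ?x ^ r * ev c z - ?x ^ (r + (?\<phi> - r)) * ev w z"
      using rel[OF z] r by simp
    also have "\<dots> = ev (X_minus_one ^ r * s) z"
      unfolding s_def power_add by (simp add: algebra_simps del: ev_pCons)
    finally show "ev (G * c) z = ev (X_minus_one ^ r * s) z" .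
  qed
  then have eq2: "root_norm G * root_norm c = root_norm X_minus_one ^ r * root_norm s" by (simp add: root_norm_mult root_norm_power)
  have "root_norm G \<noteq> 0" using eq2 nX ns0 by auto
  then have "multiplicity (int p) (root_norm G * root_norm c) = multiplicity (int p) (root_norm G)"
    using nc nc0 pi by (simp add: prime_elem_multiplicity_mult_distrib not_dvd_imp_multiplicity_0)
  moreover have "multiplicity (int p) (root_norm X_minus_one ^ r * root_norm s) = r"
    using ns ns0 nX pi mX by (simp add: prime_elem_multiplicity_mult_distrib
      prime_elem_multiplicity_power_distrib not_dvd_imp_multiplicity_0)
  ultimately show ?thesis using eq2 by simp
qed

end

text \<open>
  The ring \<open>\<int>[T]/(l, G)\<close> is finite when \<open>G\<close> is monic up to sign, so two powers of \<open>T\<close> coincide in it.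
\<close>

lemma powers_eventually_congruent:
  fixes G :: "int poly"
  assumes G: "\<bar>lead_coeff G\<bar> = 1" and l: "l > 0"
  obtains i j :: nat and a b where "i < j" "monom 1 j - monom 1 i = Polynomial.smult l a + G * b"
proof -
  (* Normalised to be monic, so that division with remainder stays integral. *)
  define H where "H = Polynomial.smult (lead_coeff G) G"
  define rem where "rem i = pseudo_mod (monom 1 i) H" for i :: nat
  have lc: "lead_coeff H = 1" using G by (auto simp: H_def abs_if split: if_splits)
  then have H0: "H \<noteq> 0" by auto
  have div: "\<exists>q. monom 1 i = H * q + rem i" for i
  proof -
    obtain q where "pseudo_divmod (monom 1 i) H = (q, rem i)"
      unfolding rem_def by (metis pseudo_mod_def prod.collapse)
    from pseudo_divmod(1)[OF H0 this] show ?thesis by (auto simp: lc)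
  qed
  have small: "coeff (rem i) n = 0" if "n \<ge> degree H" for i n
  proof (cases "rem i = 0")
    case False
    then have "degree (rem i) < degree H" using pseudo_mod(2)[OF H0] by (auto simp: rem_def)
    then show ?thesis using that by (intro coeff_eq_0) simp
  qed simp
  define code where "code i = map (\<lambda>n. coeff (rem i) n mod l) [0..<degree H]" for i
  have "range code \<subseteq> {xs. set xs \<subseteq> {0..<l} \<and> length xs = degree H}"
    using l by (auto simp: code_def)
  then have "finite (range code)" by (rule finite_subset) (simp add: finite_lists_length_eq)
  then have "\<not> inj code" using finite_imageD infinite_UNIV_nat by blast
  then obtain i j where ij: "i < j" "code i = code j"
    unfolding inj_def by (metis linorder_neqE_nat)
  have "l dvd coeff (rem j - rem i) n" for n
  proof (cases "n < degree H")
    case True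
    then have "code j ! n = code i ! n" using ij by simp
    then show ?thesis using True by (simp add: code_def mod_eq_dvd_iff)
  qed (simp add: small)
  then have "[:l:] dvd rem j - rem i" by (simp add: const_poly_dvd_iff)
  then obtain a where a: "rem j - rem i = [:l:] * a" by (elim dvdE)
  obtain q q' where "monom 1 i = H * q + rem i" "monom 1 j = H * q' + rem j" using div by metis
  then have "monom 1 j - monom 1 i = (rem j - rem i) + H * (q' - q)"
    by (simp add: algebra_simps)
  also have "\<dots> = Polynomial.smult l a + G * Polynomial.smult (lead_coeff G) (q' - q)"
    by (simp add: a H_def)
  finally show ?thesis using that[OF ij(1)] by blast
qed

lemma root_of_unity_gcd:
  fixes z :: "'a::field"
  assumes "z ^ a = 1" "z ^ b = 1" shows "z ^ gcd a b = 1"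
proof (cases "a = 0")
  case False
  then obtain x y where "a * x = b * y + gcd a b" using bezout_nat by blast
  then have "z ^ (a * x) = z ^ (b * y) * z ^ gcd a b" by (simp only: power_add)
  also have "z ^ (b * y) = 1" by (simp only: power_mult assms power_one)
  also have "z ^ (a * x) = 1" by (simp only: power_mult assms power_one)
  finally show ?thesis by simp
qed (use assms in auto)

lemma sum_index_powers:
  fixes y :: "'a::field"
  assumes "y ^ q = 1" "y \<noteq> 1"
  shows "(\<Sum>t<q. of_nat t * y ^ t) * (y - 1) = of_nat q"
proof -
  have "(\<Sum>t<n. of_nat t * y ^ t) * (y - 1) + y * (\<Sum>t<n. y ^ t) = of_nat n * y ^ n" for n
    by (induction n) (auto simp: algebra_simps)
  from this[of q] show ?thesis using assms geometric_sum[of y q] by simp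
qed

text \<open>
  The difference \<open>z^j - z^i\<close> divides \<open>p^(m+1)\<close> in \<open>\<int>[z]\<close>, because the order of \<open>z\<close> exceeds \<open>j\<close>
  (\<open>sum_index_powers\<close> with \<open>y = z^(j-i)\<close>). So \<open>G(z)\<close> divides a power of \<open>p\<close> modulo \<open>l\<close>.
\<close>

lemma (in p_power_level) root_norm_coprime_other:
  assumes l: "prime l" "l \<noteq> p" and ij: "i < j" "j < p ^ Suc m"
    and rel: "monom 1 j - monom 1 i = Polynomial.smult (int l) a + G * b"
  shows "\<not> int l dvd root_norm G"
proof
  assume dvd: "int l dvd root_norm G"
  define q where "q = p ^ Suc m"
  define d where "d = j - i"
  (* e(z) (z^j - z^i) = q: the monomial cancels z^i, the sum is q / (z^d - 1). *)
  define e :: "int poly" where "e = monom 1 (i * (q - 1)) * (\<Sum>t<q. monom (int t) (t * d))"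
  have p2: "p \<ge> 2" using p prime_ge_2_nat by blast
  then have q0: "q > 0" by (simp add: q_def)
  have key: "ev (G * (b * e)) z = ev [:int q:] z + of_int (int l) * ev (- (a * e)) z"
    if z: "z \<in> level_roots p m" for z
  proof -
    have zq: "z ^ q = 1" and zm: "z ^ p ^ m \<noteq> 1" using z by (simp_all add: level_roots_def q_def)
    have "z ^ d \<noteq> 1"
    proof
      assume "z ^ d = 1"
      then have g: "z ^ gcd d q = 1" using zq by (rule root_of_unity_gcd)
      obtain t where t: "t \<le> Suc m" "gcd d q = p ^ t"
        using divides_primepow_nat[OF p, of "gcd d q" "Suc m"] unfolding q_def by auto
      have "d > 0" "d < q" using ij by (simp_all add: d_def q_def)
      then have "gcd d q < q" using gcd_le1_nat[of d q] by linarith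
      then have "t \<noteq> Suc m" using t by (auto simp: q_def)
      then have "t \<le> m" using t by simp
      then have "p ^ m = p ^ t * p ^ (m - t)" by (simp flip: power_add)
      then have "z ^ p ^ m = (z ^ p ^ t) ^ p ^ (m - t)" by (simp only: power_mult)
      then show False using g t zm by simp
    qed
    moreover have "(z ^ d) ^ q = 1" by (metis zq power_mult mult.commute power_one)
    ultimately have s: "(\<Sum>t<q. of_nat t * (z ^ d) ^ t) * (z ^ d - 1) = of_nat q"
      by (intro sum_index_powers)
    have "ev e z * (z ^ j - z ^ i) = z ^ (i * (q - 1)) * (\<Sum>t<q. of_nat t * (z ^ d) ^ t) * (z ^ i * (z ^ d - 1))"
    proof -
      have "z ^ j = z ^ i * z ^ d" using ij by (simp add: d_def flip: power_add)
      moreover have "ev e z = z ^ (i * (q - 1)) * (\<Sum>t<q. of_nat t * (z ^ d) ^ t)"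
        by (simp add: e_def flip: power_mult) (simp add: mult.commute)
      ultimately show ?thesis by (simp add: algebra_simps)
    qed
    also have "\<dots> = z ^ (i * (q - 1) + i) * of_nat q"
      by (simp only: power_add s[symmetric] mult_ac)
    also have "i * (q - 1) + i = q * i" using q0 by (cases q) auto
    also have "z ^ (q * i) = 1" by (simp only: power_mult zq power_one)
    finally have "ev e z * (z ^ j - z ^ i) = of_nat q" by simp
    moreover have "z ^ j - z ^ i = of_int (int l) * ev a z + ev G z * ev b z"
      using arg_cong[OF rel, of "\<lambda>s. ev s z"] by simp
    ultimately show ?thesis by (simp add: algebra_simps)
  qed
  have "[root_norm (G * (b * e)) = root_norm [:int q:]] (mod int l)" by (rule root_norm_cong) (rule key)
  moreover have "int l dvd root_norm (G * (b * e))" unfolding root_norm_mult using dvd by (rule dvd_mult2)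
  ultimately have "int l dvd root_norm [:int q:]" by (simp add: cong_dvd_iff)
  then have "int l dvd int (q ^ card (level_roots p m))" by (simp add: root_norm_const)
  then have "l dvd q ^ card (level_roots p m)" by (simp only: int_dvd_int_iff)
  then have "l dvd p" unfolding q_def using prime_dvd_power[OF l(1)] by metis
  then show False using primes_dvd_imp_eq[OF l(1) p] l(2) by simp
qed

section \<open>The group \<open>\<int>\<^sub>p\<close> and its finite quotients\<close>

context
  fixes p :: nat
  assumes p_pos: "p > 0"
begin

lemma Zp_simps:
  "x \<in> carrier (Zp p) \<longleftrightarrow> (\<forall>n. x n \<in> {0..<int p ^ n} \<and> x (Suc n) mod int p ^ n = x n)"
  "(x \<otimes>\<^bsub>Zp p\<^esub> y) n = (x n + y n) mod int p ^ n"
  "\<one>\<^bsub>Zp p\<^esub> n = 0"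
  by (simp_all add: Zp_def)

lemma mod_Suc_power: "(a mod int p ^ Suc n) mod int p ^ n = a mod int p ^ n"
  by (rule mod_mod_cancel) simp

lemma Zp_bounds: "x \<in> carrier (Zp p) \<Longrightarrow> 0 \<le> x n \<and> x n < int p ^ n"
  by (simp add: Zp_simps)

lemma Zp_mod_self: "x \<in> carrier (Zp p) \<Longrightarrow> x n mod int p ^ n = x n"
  using Zp_bounds[of x n] by simp

lemma Zp_mod_Suc: "x \<in> carrier (Zp p) \<Longrightarrow> x (Suc n) mod int p ^ n = x n"
  by (simp add: Zp_simps)

definition residues_of :: "(nat \<Rightarrow> int) \<Rightarrow> nat \<Rightarrow> int" where
  "residues_of f = (\<lambda>n. f n mod int p ^ n)"

lemma residues_of_in_Zp:
  assumes "\<And>n. f (Suc n) mod int p ^ n = f n mod int p ^ n"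
  shows "residues_of f \<in> carrier (Zp p)"
  using assms p_pos by (simp add: Zp_simps residues_of_def mod_Suc_power del: power_Suc)

lemma Zp_mult_eq: "x \<otimes>\<^bsub>Zp p\<^esub> y = residues_of (\<lambda>n. x n + y n)"
  by (rule ext) (simp add: Zp_simps residues_of_def)

lemma Zp_mult_closed:
  assumes "x \<in> carrier (Zp p)" "y \<in> carrier (Zp p)"
  shows "x \<otimes>\<^bsub>Zp p\<^esub> y \<in> carrier (Zp p)"
  unfolding Zp_mult_eq
proof (rule residues_of_in_Zp)
  fix n
  have "(x (Suc n) + y (Suc n)) mod int p ^ n = (x (Suc n) mod int p ^ n + y (Suc n) mod int p ^ n) mod int p ^ n"
    by (rule mod_add_eq[symmetric])
  then show "(x (Suc n) + y (Suc n)) mod int p ^ n = (x n + y n) mod int p ^ n"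
    by (simp only: Zp_mod_Suc assms)
qed

definition Zp_of_int :: "int \<Rightarrow> nat \<Rightarrow> int" where
  "Zp_of_int a = residues_of (\<lambda>_. a)"

lemma Zp_of_int_in_Zp: "Zp_of_int a \<in> carrier (Zp p)"
  unfolding Zp_of_int_def by (rule residues_of_in_Zp) simp

definition Zp_minus :: "(nat \<Rightarrow> int) \<Rightarrow> nat \<Rightarrow> int" where
  "Zp_minus x = residues_of (\<lambda>n. - x n)"

lemma Zp_minus_in_Zp:
  assumes "x \<in> carrier (Zp p)"
  shows "Zp_minus x \<in> carrier (Zp p)"
  unfolding Zp_minus_def
proof (rule residues_of_in_Zp)
  fix n
  have "- x (Suc n) mod int p ^ n = - (x (Suc n) mod int p ^ n) mod int p ^ n" by (rule mod_minus_eq[symmetric])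
  then show "- x (Suc n) mod int p ^ n = - x n mod int p ^ n" by (simp only: Zp_mod_Suc assms)
qed

lemma Zp_minus_mult: "Zp_minus x \<otimes>\<^bsub>Zp p\<^esub> x = \<one>\<^bsub>Zp p\<^esub>"
  by (rule ext) (simp add: Zp_simps Zp_minus_def residues_of_def mod_add_left_eq)

lemma comm_group_Zp: "comm_group (Zp p)"
proof (rule comm_groupI)
  fix x y z
  show "x \<otimes>\<^bsub>Zp p\<^esub> y \<otimes>\<^bsub>Zp p\<^esub> z = x \<otimes>\<^bsub>Zp p\<^esub> (y \<otimes>\<^bsub>Zp p\<^esub> z)"
    by (rule ext) (simp add: Zp_simps mod_simps add.assoc)
  show "x \<otimes>\<^bsub>Zp p\<^esub> y = y \<otimes>\<^bsub>Zp p\<^esub> x"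
    by (rule ext) (simp add: Zp_simps add.commute)
  assume x: "x \<in> carrier (Zp p)"
  show "\<one>\<^bsub>Zp p\<^esub> \<otimes>\<^bsub>Zp p\<^esub> x = x"
    by (rule ext) (simp add: Zp_simps(2,3) Zp_mod_self[OF x])
  show "\<exists>y\<in>carrier (Zp p). y \<otimes>\<^bsub>Zp p\<^esub> x = \<one>\<^bsub>Zp p\<^esub>"
    using Zp_minus_mult Zp_minus_in_Zp[OF x] by blast
qed (use p_pos Zp_mult_closed in \<open>simp_all add: Zp_simps\<close>)

lemma group_Zp: "group (Zp p)"
  using comm_group_Zp by (rule comm_group.axioms(2))

lemma inv_Zp_of_int: "inv\<^bsub>Zp p\<^esub> (Zp_of_int a) = Zp_of_int (- a)"
proof (rule group.inv_equality[OF group_Zp])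
  show "Zp_of_int (- a) \<otimes>\<^bsub>Zp p\<^esub> Zp_of_int a = \<one>\<^bsub>Zp p\<^esub>"
    by (rule ext) (simp add: Zp_simps(2,3) Zp_of_int_def residues_of_def mod_simps)
qed (rule Zp_of_int_in_Zp)+

lemma Zp_pow: "x \<in> carrier (Zp p) \<Longrightarrow> (x [^]\<^bsub>Zp p\<^esub> (k::nat)) n = (int k * x n) mod int p ^ n"
  by (induction k) (simp_all add: Zp_simps(2,3) mod_simps algebra_simps)

lemma Zp_mod_add: "x \<in> carrier (Zp p) \<Longrightarrow> x (m + k) mod int p ^ m = x m"
proof (induction k)
  case (Suc k)
  have "x (m + Suc k) mod int p ^ m = (x (Suc (m + k)) mod int p ^ (m + k)) mod int p ^ m"
    by (simp add: mod_mod_cancel le_imp_power_dvd)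
  then show ?case using Suc by (simp only: Zp_mod_Suc)
qed (simp add: Zp_mod_self)

definition residue_class :: "nat \<Rightarrow> int \<Rightarrow> (nat \<Rightarrow> int) set" where
  "residue_class n i = {x \<in> carrier (Zp p). x n = i}"

text \<open>
  An element whose component at \<open>n\<close> vanishes is \<open>p^n\<close> times the element with components
  \<open>x (m + n) / p^n\<close>.
\<close>

lemma level_subgroup_Zp: "level_subgroup p (Zp p) n = residue_class n 0"
proof
  show "level_subgroup p (Zp p) n \<subseteq> residue_class n 0"
    using group.is_monoid[OF group_Zp]
    by (auto simp: level_subgroup_def residue_class_def Zp_pow intro!: monoid.nat_pow_closed)
  show "residue_class n 0 \<subseteq> level_subgroup p (Zp p) n"
  proof
    fix x assume "x \<in> residue_class n 0"
    then have x: "x \<in> carrier (Zp p)" "x n = 0" by (auto simp: residue_class_def)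
    define y where "y m = x (m + n) div int p ^ n" for m
    have dvd: "int p ^ n * y m = x (m + n)" for m
      using Zp_mod_add[OF x(1), of n m] x(2) by (simp add: y_def add.commute dvd_eq_mod_eq_0)
    have "y \<in> carrier (Zp p)"
      unfolding Zp_simps
    proof (intro allI conjI)
      fix m
      have pn: "int p ^ n > 0" using p_pos by simp
      have "0 \<le> int p ^ n * y m" "int p ^ n * y m < int p ^ n * int p ^ m"
        using Zp_bounds[OF x(1), of "m + n"] unfolding dvd by (simp_all add: power_add mult.commute)
      then show "y m \<in> {0..<int p ^ m}" using pn
        by (simp add: zero_le_mult_iff mult_less_cancel_left_pos)
      have "int p ^ n * (y (Suc m) mod int p ^ m) = (int p ^ n * y (Suc m)) mod (int p ^ n * int p ^ m)"
        by (rule mult_mod_right)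
      also have "\<dots> = x (Suc (m + n)) mod int p ^ (m + n)"
        unfolding dvd by (simp add: power_add mult.commute)
      also have "\<dots> = int p ^ n * y m" unfolding dvd by (rule Zp_mod_Suc[OF x(1)])
      finally have eq: "int p ^ n * (y (Suc m) mod int p ^ m) = int p ^ n * y m" .
      from pn have "int p ^ n \<noteq> 0" by linarith
      then show "y (Suc m) mod int p ^ m = y m" using eq by (rule mult_left_cancel[THEN iffD1])
    qed
    moreover have "x = y [^]\<^bsub>Zp p\<^esub> (p ^ n)"
    proof
      fix m
      have "(y [^]\<^bsub>Zp p\<^esub> (p ^ n)) m = x (m + n) mod int p ^ m"
        using Zp_pow[OF \<open>y \<in> carrier (Zp p)\<close>, of "p ^ n" m] dvd[of m] by simp
      then show "x m = (y [^]\<^bsub>Zp p\<^esub> (p ^ n)) m" using Zp_mod_add[OF x(1)] by simp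
    qed
    ultimately show "x \<in> level_subgroup p (Zp p) n" unfolding level_subgroup_def by blast
  qed
qed

text \<open>
  Every element of the class of \<open>i + j\<close> is a translate by \<open>y\<close> of an element of the class of \<open>i\<close>; this
  computes both the cosets of the level subgroups and their products.
\<close>

lemma residue_class_mult:
  assumes y: "y \<in> carrier (Zp p)" "y n = j" and x: "x \<in> residue_class n ((i + j) mod int p ^ n)"
    and i: "i mod int p ^ n = i"
  obtains z where "z \<in> residue_class n i" "x = z \<otimes>\<^bsub>Zp p\<^esub> y"
proof
  interpret comm_group "Zp p" by (rule comm_group_Zp)
  have xc: "x \<in> carrier (Zp p)" "x n = (i + j) mod int p ^ n" using x by (auto simp: residue_class_def)
  let ?z = "x \<otimes>\<^bsub>Zp p\<^esub> Zp_minus y"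
  have "?z n = i"
    using xc(2) y(2) i by (simp add: Zp_simps(2) Zp_minus_def residues_of_def mod_simps)
  then show "?z \<in> residue_class n i"
    using xc(1) Zp_minus_in_Zp[OF y(1)] by (simp add: residue_class_def)
  show "x = ?z \<otimes>\<^bsub>Zp p\<^esub> y"
    using xc(1) y(1) Zp_minus_in_Zp[OF y(1)] by (simp add: m_assoc Zp_minus_mult)
qed

lemma level_coset_Zp:
  assumes a: "a \<in> carrier (Zp p)"
  shows "level_subgroup p (Zp p) n #>\<^bsub>Zp p\<^esub> a = residue_class n (a n)"
proof
  interpret comm_group "Zp p" by (rule comm_group_Zp)
  show "level_subgroup p (Zp p) n #>\<^bsub>Zp p\<^esub> a \<subseteq> residue_class n (a n)"
    using a by (auto simp: level_subgroup_Zp r_coset_def residue_class_def Zp_simps(2) Zp_mod_self)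
  show "residue_class n (a n) \<subseteq> level_subgroup p (Zp p) n #>\<^bsub>Zp p\<^esub> a"
  proof
    fix x assume "x \<in> residue_class n (a n)"
    then have "x \<in> residue_class n ((0 + a n) mod int p ^ n)" by (simp add: Zp_mod_self[OF a])
    then obtain z where "z \<in> residue_class n 0" "x = z \<otimes>\<^bsub>Zp p\<^esub> a"
      using residue_class_mult[OF a refl, of x n 0] by auto
    then show "x \<in> level_subgroup p (Zp p) n #>\<^bsub>Zp p\<^esub> a"
      by (auto simp: level_subgroup_Zp r_coset_def)
  qed
qed

lemma residue_class_nonempty:
  assumes "0 \<le> i" "i < int p ^ n"
  shows "Zp_of_int i \<in> residue_class n i"
  using assms Zp_of_int_in_Zp by (simp add: residue_class_def Zp_of_int_def residues_of_def)

lemma carrier_level_group_Zp: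
  "carrier (level_group p (Zp p) n) = (\<lambda>i. residue_class n (int i)) ` {..<p ^ n}"
proof -
  have "carrier (level_group p (Zp p) n) = (\<lambda>a. residue_class n (a n)) ` carrier (Zp p)"
    by (auto simp: level_group_def FactGroup_def RCOSETS_def level_coset_Zp)
  also have "\<dots> = (\<lambda>i. residue_class n (int i)) ` {..<p ^ n}"
  proof (intro equalityI subsetI)
    fix C assume "C \<in> (\<lambda>a. residue_class n (a n)) ` carrier (Zp p)"
    then obtain a where a: "a \<in> carrier (Zp p)" "C = residue_class n (a n)" by blast
    have "C = residue_class n (int (nat (a n)))" "nat (a n) < p ^ n"
      using Zp_bounds[OF a(1), of n] a(2) by (simp_all add: nat_less_iff)
    then show "C \<in> (\<lambda>i. residue_class n (int i)) ` {..<p ^ n}" by blast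
  next
    fix C assume "C \<in> (\<lambda>i. residue_class n (int i)) ` {..<p ^ n}"
    then obtain i where i: "i < p ^ n" "C = residue_class n (int i)" by blast
    then have "int i < int p ^ n" by (simp flip: of_nat_power)
    then have "Zp_of_int (int i) n = int i" by (simp add: Zp_of_int_def residues_of_def)
    then show "C \<in> (\<lambda>a. residue_class n (a n)) ` carrier (Zp p)"
      using i Zp_of_int_in_Zp[of "int i"] by (intro image_eqI[of _ _ "Zp_of_int (int i)"]) simp_all
  qed
  finally show ?thesis .
qed

lemma level_mult_Zp:
  assumes a: "a \<in> carrier (Zp p)" and i: "0 \<le> i" "i < int p ^ n"
  shows "level_mult p (Zp p) n (residue_class n i) a = residue_class n ((i + a n) mod int p ^ n)"
proof -
  interpret comm_group "Zp p" by (rule comm_group_Zp)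
  have "level_mult p (Zp p) n (residue_class n i) a = residue_class n i <#>\<^bsub>Zp p\<^esub> residue_class n (a n)"
    by (simp add: level_mult_def level_group_def FactGroup_def level_coset_Zp[OF a])
  also have "\<dots> = residue_class n ((i + a n) mod int p ^ n)"
  proof
    show "residue_class n i <#>\<^bsub>Zp p\<^esub> residue_class n (a n) \<subseteq> residue_class n ((i + a n) mod int p ^ n)"
      by (auto simp: set_mult_def residue_class_def Zp_simps(2))
    show "residue_class n ((i + a n) mod int p ^ n) \<subseteq> residue_class n i <#>\<^bsub>Zp p\<^esub> residue_class n (a n)"
    proof
      fix x assume "x \<in> residue_class n ((i + a n) mod int p ^ n)"
      then obtain z where "z \<in> residue_class n i" "x = z \<otimes>\<^bsub>Zp p\<^esub> a"
        using residue_class_mult[OF a refl] i by (metis mod_pos_pos_trivial)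
      then show "x \<in> residue_class n i <#>\<^bsub>Zp p\<^esub> residue_class n (a n)"
        using a by (auto simp: set_mult_def residue_class_def)
    qed
  qed
  finally show ?thesis .
qed

lemma residue_class_inj:
  "inj_on (\<lambda>i. residue_class n (int i)) {..<p ^ n}"
proof (rule inj_onI)
  fix i j assume ij: "i \<in> {..<p ^ n}" "j \<in> {..<p ^ n}" "residue_class n (int i) = residue_class n (int j)"
  then have "int i < int p ^ n" by (simp flip: of_nat_power)
  then have "Zp_of_int (int i) \<in> residue_class n (int i)" by (intro residue_class_nonempty) simp_all
  then show "i = j" using ij(3) \<open>Zp_of_int (int i) \<in> residue_class n (int i)\<close>
    by (auto simp: residue_class_def)
qed

end

section \<open>Bouquets and their derived graphs\<close>

definition bouquet :: "nat list \<Rightarrow> (nat, nat) pre_digraph" where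
  "bouquet xs = \<lparr>verts = {0}, arcs = {..<2 * length xs}, tail = (\<lambda>_. 0), head = (\<lambda>_. 0)\<rparr>"

text \<open>
  The loop with number \<open>i\<close> consists of the two oriented edges \<open>2 i\<close> and \<open>2 i + 1\<close>, which have the
  voltages \<open>xs ! i\<close> and \<open>- xs ! i\<close>.
\<close>

definition bouquet_rev :: "nat list \<Rightarrow> nat \<Rightarrow> nat" where
  "bouquet_rev xs e = (if e < 2 * length xs then (if even e then Suc e else e - 1) else e)"

definition voltage :: "nat list \<Rightarrow> nat \<Rightarrow> int" where
  "voltage xs e = (if even e then int (xs ! (e div 2)) else - int (xs ! (e div 2)))"

lemma bouquet_rev_arc:
  assumes "e < 2 * length xs"
  shows "bouquet_rev xs e < 2 * length xs" "bouquet_rev xs e \<noteq> e"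
    "bouquet_rev xs (bouquet_rev xs e) = e" "voltage xs (bouquet_rev xs e) = - voltage xs e"
  using assms by (auto simp: bouquet_rev_def voltage_def elim!: evenE oddE)

lemma bouquet_rev_non_arc: "\<not> e < 2 * length xs \<Longrightarrow> bouquet_rev xs e = e"
  by (simp add: bouquet_rev_def)

lemma fin_digraph_bouquet: "fin_digraph (bouquet xs)"
  by unfold_locales (simp_all add: bouquet_def)

lemma bidirected_bouquet: "bidirected_digraph (bouquet xs) (bouquet_rev xs)"
proof (rule wf_digraph.bidirected_digraphI)
  show "wf_digraph (bouquet xs)" using fin_digraph_bouquet by (rule fin_digraph.axioms(1))
qed (auto simp: bouquet_rev_arc bouquet_rev_non_arc bouquet_def)

lemma sum_arc_pairs: "(\<Sum>e<2 * m. f e) = (\<Sum>i<m. f (2 * i) + f (Suc (2 * i)) :: 'a::comm_monoid_add)"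
  by (induction m) (simp_all add: ac_simps)

lemma root_power_int_mod:
  fixes z :: complex
  assumes z: "z ^ q = 1" and q: "q > 0"
  shows "z ^ nat (int x mod int q) = z ^ x" "z ^ nat (- int x mod int q) = inverse (z ^ x)"
proof -
  show "z ^ nat (int x mod int q) = z ^ x"
    by (simp add: nat_mod_as_int[symmetric] root_power_mod[OF z] flip: zmod_int)
  have "int (nat (- int x mod int q) + x) mod int q = 0"
    using q by (simp add: mod_simps)
  then have "q dvd nat (- int x mod int q) + x" by (metis int_dvd_int_iff dvd_eq_mod_eq_0)
  then have "z ^ (nat (- int x mod int q) + x) = 1" using z by (auto simp: power_mult elim!: dvdE)
  then have "z ^ nat (- int x mod int q) * z ^ x = 1" by (simp only: power_add)
  then show "z ^ nat (- int x mod int q) = inverse (z ^ x)"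
    by (metis inverse_unique mult.commute)
qed

locale bouquet_tower =
  fixes p :: nat and xs :: "nat list" and n :: nat
  assumes p_pos: "p > 0"
begin

abbreviation "q \<equiv> p ^ n"
abbreviation "\<alpha> \<equiv> \<lambda>e. Zp_of_int p (voltage xs e)"
abbreviation "X\<^sub>n \<equiv> derived_graph p (Zp p) (bouquet xs) \<alpha> n"
abbreviation "rev\<^sub>n \<equiv> derived_arev p (Zp p) (bouquet xs) (bouquet_rev xs) \<alpha> n"

definition vtx :: "nat \<Rightarrow> (nat \<Rightarrow> int) set" where
  "vtx i = residue_class p n (int i)"

text \<open>
  The voltage of an edge as a step on \<open>\<int>/p\<^sup>n\<close>.
\<close>

definition shift :: "nat \<Rightarrow> nat" where
  "shift e = nat (voltage xs e mod int q)"

lemma q_pos: "q > 0" using p_pos by simp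

lemma carrier_eq: "carrier (level_group p (Zp p) n) = vtx ` {..<q}"
  unfolding vtx_def by (rule carrier_level_group_Zp[OF p_pos])

lemma vtx_inj: "inj_on vtx {..<q}"
  unfolding vtx_def by (rule residue_class_inj[OF p_pos])

lemma level_mult_vtx:
  assumes "i < q"
  shows "level_mult p (Zp p) n (vtx i) (\<alpha> e) = vtx ((i + shift e) mod q)"
proof -
  have "int i < int p ^ n" using assms by (simp flip: of_nat_power)
  then have "level_mult p (Zp p) n (vtx i) (\<alpha> e) = residue_class p n ((int i + \<alpha> e n) mod int p ^ n)"
    unfolding vtx_def by (intro level_mult_Zp p_pos Zp_of_int_in_Zp) simp_all
  also have "(int i + \<alpha> e n) mod int p ^ n = int ((i + shift e) mod q)"
    using p_pos by (simp add: shift_def Zp_of_int_def[OF p_pos] residues_of_def[OF p_pos] zmod_int mod_simps)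
  finally show ?thesis by (simp add: vtx_def)
qed

lemma shift_rev:
  assumes "e < 2 * length xs" "i < q"
  shows "((i + shift e) mod q + shift (bouquet_rev xs e)) mod q = i"
proof -
  have "(int i + voltage xs e mod int q - voltage xs e) mod int q = int i mod int q"
    by (metis add_diff_cancel_right' mod_add_right_eq mod_diff_left_eq)
  then have "int (((i + shift e) mod q + shift (bouquet_rev xs e)) mod q) = int i mod int q"
    using p_pos assms(1) by (simp add: shift_def bouquet_rev_arc zmod_int mod_simps)
  then show ?thesis using assms(2) by (simp flip: zmod_int)
qed

lemma verts_X: "verts X\<^sub>n = vtx ` {..<q} \<times> {0}"
  and arcs_X: "arcs X\<^sub>n = vtx ` {..<q} \<times> {..<2 * length xs}"
  and tail_X: "tail X\<^sub>n (\<gamma>, e) = (\<gamma>, 0)"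
  and head_X: "i < q \<Longrightarrow> head X\<^sub>n (vtx i, e) = (vtx ((i + shift e) mod q), 0)"
  by (simp_all add: derived_graph_def carrier_eq bouquet_def level_mult_vtx)

lemma vtx_mod_in: "vtx (j mod q) \<in> vtx ` {..<q}"
  using q_pos by simp

lemma fin_digraph_X: "fin_digraph X\<^sub>n"
proof
  show "finite (verts X\<^sub>n)" "finite (arcs X\<^sub>n)" by (simp_all add: verts_X arcs_X)
  fix e assume "e \<in> arcs X\<^sub>n"
  then show "tail X\<^sub>n e \<in> verts X\<^sub>n" "head X\<^sub>n e \<in> verts X\<^sub>n"
    by (auto simp: arcs_X verts_X tail_X head_X vtx_mod_in simp del: vtx_mod_in image_iff intro!: vtx_mod_in)
qed

lemma rev_X:
  assumes "i < q" "e < 2 * length xs"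
  shows "rev\<^sub>n (vtx i, e) = (vtx ((i + shift e) mod q), bouquet_rev xs e)"
  using assms by (simp add: derived_arev_def arcs_X level_mult_vtx)

lemma bidirected_X: "bidirected_digraph X\<^sub>n rev\<^sub>n"
proof (rule wf_digraph.bidirected_digraphI)
  show "wf_digraph X\<^sub>n" using fin_digraph_X by (rule fin_digraph.axioms(1))
  show "rev\<^sub>n a = a" if "a \<notin> arcs X\<^sub>n" for a
    using that by (cases a) (simp add: derived_arev_def)
  fix a assume "a \<in> arcs X\<^sub>n"
  then obtain i e where a: "a = (vtx i, e)" "i < q" "e < 2 * length xs" by (auto simp: arcs_X)
  have j: "(i + shift e) mod q < q" using q_pos by simp
  show "rev\<^sub>n a \<noteq> a" using a bouquet_rev_arc(2)[OF a(3)] by (simp add: rev_X)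
  show "rev\<^sub>n (rev\<^sub>n a) = a"
    using a by (simp add: rev_X j bouquet_rev_arc shift_rev)
  show "tail X\<^sub>n (rev\<^sub>n a) = head X\<^sub>n a" using a by (simp add: rev_X tail_X head_X)
qed

theorem spanning_trees_product:
  "of_nat q * of_nat (num_spanning_trees X\<^sub>n rev\<^sub>n) =
    (\<Prod>z::complex | z ^ q = 1 \<and> z \<noteq> 1. \<Sum>i<length xs. 2 - z ^ (xs ! i) - inverse (z ^ (xs ! i)))"
proof -
  obtain N where N: "q = Suc N" using q_pos by (cases q) auto
  define \<phi> :: "nat \<Rightarrow> (nat \<Rightarrow> int) set \<times> nat" where "\<phi> i = (vtx i, 0)" for i
  interpret rooted_graph "X\<^sub>n" "rev\<^sub>n" "\<phi> 0"
    using fin_digraph_X bidirected_X q_pos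
    by (auto simp: rooted_graph_def rooted_graph_axioms_def verts_X \<phi>_def)
  have \<phi>: "bij_betw \<phi> {..<Suc N} (verts X\<^sub>n)"
    unfolding N[symmetric] verts_X bij_betw_def using vtx_inj by (auto simp: \<phi>_def inj_on_def)
  let ?E = "{..<2 * length xs}"
  let ?L = "\<lambda>i j. \<Sum>e\<in>?E. (if i = j then 1 else 0) - (if (i + shift e) mod q = j then 1 else 0 :: complex)"
  have entry: "(\<Sum>a \<in> out_arcs X\<^sub>n (\<phi> (Suc i)). (if i = j then 1 else 0) -
      (if head X\<^sub>n a = \<phi> (Suc j) then 1 else 0)) = ?L (Suc i) (Suc j)" if ij: "i < N" "j < N" for i j
  proof -
    have i: "Suc i < q" and j: "Suc j < q" using ij N by simp_all
    have out: "out_arcs X\<^sub>n (\<phi> (Suc i)) = Pair (vtx (Suc i)) ` ?E"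
      using i by (auto simp: out_arcs_def arcs_X tail_X \<phi>_def)
    have hd: "head X\<^sub>n (vtx (Suc i), e) = \<phi> (Suc j) \<longleftrightarrow> (Suc i + shift e) mod q = Suc j" for e
      using inj_onD[OF vtx_inj, of "(Suc i + shift e) mod q" "Suc j"] j q_pos
      by (auto simp: head_X[OF i] \<phi>_def)
    show ?thesis unfolding out by (subst sum.reindex) (auto simp: inj_on_def hd)
  qed
  have "of_nat (num_spanning_trees X\<^sub>n rev\<^sub>n) = det (mat N N (\<lambda>(i, j). ?L (Suc i) (Suc j)))"
    unfolding matrix_tree[OF \<phi> refl, symmetric]
    by (intro arg_cong[where f = det] cong_mat refl) (simp only: entry prod.case)
  also have "mat N N (\<lambda>(i, j). ?L (Suc i) (Suc j)) = mat (q - 1) (q - 1) (\<lambda>(i, j). ?L (Suc i) (Suc j))"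
    using N by simp
  finally have "of_nat q * of_nat (num_spanning_trees X\<^sub>n rev\<^sub>n) =
      (\<Prod>z::complex | z ^ q = 1 \<and> z \<noteq> 1. \<Sum>e\<in>?E. 1 - inverse (z ^ shift e))"
    by (simp only: det_reduced_cayley_laplacian[OF q_pos])
  also have "\<dots> = (\<Prod>z::complex | z ^ q = 1 \<and> z \<noteq> 1. \<Sum>i<length xs. 2 - z ^ (xs ! i) - inverse (z ^ (xs ! i)))"
  proof (intro prod.cong refl)
    fix z :: complex assume "z \<in> {z. z ^ q = 1 \<and> z \<noteq> 1}"
    then have z: "z ^ q = 1" by simp
    show "(\<Sum>e\<in>?E. 1 - inverse (z ^ shift e)) = (\<Sum>i<length xs. 2 - z ^ (xs ! i) - inverse (z ^ (xs ! i)))"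
      unfolding sum_arc_pairs
      by (intro sum.cong refl)
        (simp add: shift_def voltage_def root_power_int_mod[OF z q_pos, unfolded of_nat_power])
  qed
  finally show ?thesis .
qed

lemma connected_X:
  assumes "num_spanning_trees X\<^sub>n rev\<^sub>n \<noteq> 0"
  shows "Digraph_Component.connected X\<^sub>n"
proof -
  interpret fin_digraph "X\<^sub>n" by (rule fin_digraph_X)
  have "spanning_trees X\<^sub>n rev\<^sub>n \<noteq> {}" using assms by (auto simp: num_spanning_trees_def)
  then obtain T where T: "T \<subseteq> arcs X\<^sub>n" "Digraph_Component.connected (X\<^sub>n\<lparr>arcs := T\<rparr>)"
    by (auto simp: spanning_trees_def)
  have "wf_digraph (X\<^sub>n\<lparr>arcs := T\<rparr>)" using T(1) by unfold_locales auto
  then have "spanning (X\<^sub>n\<lparr>arcs := T\<rparr>) X\<^sub>n"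
    using T(1) wf_digraph by (auto simp: spanning_def subgraph_def compatible_def)
  then show ?thesis using T(2) by (rule connected_spanning_imp_connected)
qed

end

lemma Zp_covering_bouquet:
  assumes p: "p > 0"
    and nz: "\<And>n. num_spanning_trees (derived_graph p (Zp p) (bouquet xs) (\<lambda>e. Zp_of_int p (voltage xs e)) n)
      (derived_arev p (Zp p) (bouquet xs) (bouquet_rev xs) (\<lambda>e. Zp_of_int p (voltage xs e)) n) \<noteq> 0"
  shows "Zp_covering p (Zp p) (bouquet xs) (bouquet_rev xs) (\<lambda>e. Zp_of_int p (voltage xs e))"
  unfolding Zp_covering_def
proof (intro conjI ballI allI)
  show "group (Zp p)" by (rule group_Zp[OF p])
  show "Zp p \<cong> Zp p" by (rule iso_refl)
  show "fin_digraph (bouquet xs)" by (rule fin_digraph_bouquet)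
  show "bidirected_digraph (bouquet xs) (bouquet_rev xs)" by (rule bidirected_bouquet)
  fix e assume "e \<in> arcs (bouquet xs)"
  then have e: "e < 2 * length xs" by (simp add: bouquet_def)
  show "Zp_of_int p (voltage xs e) \<in> carrier (Zp p)" by (rule Zp_of_int_in_Zp[OF p])
  show "Zp_of_int p (voltage xs (bouquet_rev xs e)) = inv\<^bsub>Zp p\<^esub> Zp_of_int p (voltage xs e)"
    by (simp only: bouquet_rev_arc(4)[OF e] inv_Zp_of_int[OF p])
next
  fix n
  interpret bouquet_tower p xs n by unfold_locales (rule p)
  show "Digraph_Component.connected (derived_graph p (Zp p) (bouquet xs) (\<lambda>e. Zp_of_int p (voltage xs e)) n)"
    by (rule connected_X) (rule nz)
qed

section \<open>A polynomial with prescribed reductions\<close>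

definition symmetric_difference_poly :: "nat \<Rightarrow> nat \<Rightarrow> int poly" where
  "symmetric_difference_poly k a = monom 2 k - monom 1 (k + a) - monom 1 (k - a)"

text \<open>
  The coefficients of \<open>-(T - 1)^(2k)\<close> as a combination of the polynomials
  \<open>2 T^k - T^(k+a) - T^(k-a)\<close>.
\<close>

definition target_coeff :: "nat \<Rightarrow> nat \<Rightarrow> int" where
  "target_coeff k a = (-1) ^ (k + a) * int ((2 * k) choose (k + a))"

lemma sum_around_centre:
  fixes f :: "nat \<Rightarrow> 'a::ab_group_add"
  shows "(\<Sum>j\<le>2 * k. f j) = f k + (\<Sum>a=1..k. f (k + a) + f (k - a))"
proof -
  have "{..2 * k} = {..<k} \<union> ({k} \<union> {k<..2 * k})" by auto
  then have "(\<Sum>j\<le>2 * k. f j) = sum f ({..<k} \<union> ({k} \<union> {k<..2 * k}))" by (simp only:)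
  also have "\<dots> = sum f {..<k} + (f k + sum f {k<..2 * k})"
    by (subst sum.union_disjoint; (subst sum.union_disjoint)?) auto
  also have "sum f {..<k} = (\<Sum>a=1..k. f (k - a))"
    by (rule sum.reindex_bij_witness[of _ "\<lambda>a. k - a" "\<lambda>j. k - j"]) auto
  also have "sum f {k<..2 * k} = (\<Sum>a=1..k. f (k + a))"
    by (rule sum.reindex_bij_witness[of _ "\<lambda>a. k + a" "\<lambda>j. j - k"]) auto
  finally show ?thesis by (simp add: sum.distrib algebra_simps)
qed

text \<open>
  The binomial coefficients of \<open>(T - 1)^(2k)\<close> are symmetric about \<open>k\<close>, and their signed sum is zero, so
  that each monomial \<open>T^j\<close> may be replaced by \<open>T^j - T^k\<close>.
\<close>

lemma target_combination:
  assumes k: "k \<ge> 1"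
  shows "(\<Sum>a=1..k. Polynomial.smult (target_coeff k a) (symmetric_difference_poly k a)) = - (X_minus_one ^ (2 * k))"
proof -
  define e where "e j = (-1) ^ j * int ((2 * k) choose j)" for j
  have X: "X_minus_one = monom 1 1 + (- 1)"
    by (rule poly_eqI) (simp add: coeff_pCons split: nat.split)
  have "X_minus_one ^ (2 * k) = (\<Sum>j\<le>2 * k. of_nat ((2 * k) choose j) * monom 1 1 ^ j * (- 1) ^ (2 * k - j))"
    unfolding X by (rule binomial_ring)
  also have "\<dots> = (\<Sum>j\<le>2 * k. monom (e j) j)"
  proof (intro sum.cong refl)
    fix j assume "j \<in> {..2 * k}"
    then have "(- 1 :: int poly) ^ (2 * k - j) = (- 1) ^ j"
      using neg_one_power_add_eq_neg_one_power_diff[of j "2 * k", where ?'a = "int poly"]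
      by (simp add: power_add)
    moreover have "(- 1 :: int poly) ^ j = [:(- 1) ^ j:]" 
      by (induction j) (simp_all add: one_pCons)
    ultimately show "of_nat ((2 * k) choose j) * monom 1 1 ^ j * (- 1) ^ (2 * k - j) = monom (e j) j"
      by (simp add: e_def monom_power of_nat_poly smult_monom mult.commute)
  qed
  finally have expand: "X_minus_one ^ (2 * k) = (\<Sum>j\<le>2 * k. monom (e j) j)" .
  have "(\<Sum>j\<le>2 * k. e j) = poly (X_minus_one ^ (2 * k)) 1"
    unfolding expand by (simp add: poly_sum poly_monom)
  also have "\<dots> = 0" using k by simp
  finally have sum0: "(\<Sum>j\<le>2 * k. e j) = 0" .
  let ?f = "\<lambda>j. monom (e j) j - monom (e j) k"
  have "X_minus_one ^ (2 * k) = (\<Sum>j\<le>2 * k. monom (e j) j) - monom (\<Sum>j\<le>2 * k. e j) k"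
    by (simp only: sum0 expand monom_0 monom_eq_0 diff_zero)
  also have "\<dots> = (\<Sum>j\<le>2 * k. ?f j)" by (simp only: monom_sum sum_subtractf)
  also have "\<dots> = ?f k + (\<Sum>a=1..k. ?f (k + a) + ?f (k - a))" by (rule sum_around_centre)
  also have "\<dots> = (\<Sum>a=1..k. ?f (k + a) + ?f (k - a))" by simp
  also have "\<dots> = (\<Sum>a=1..k. - Polynomial.smult (target_coeff k a) (symmetric_difference_poly k a))"
  proof (intro sum.cong refl)
    fix a assume "a \<in> {1..k}"
    then have a: "a \<le> k" by simp
    have "(2 * k) choose (k - a) = (2 * k) choose (2 * k - (k - a))"
      by (rule binomial_symmetric) simp
    also have "2 * k - (k - a) = k + a" using a by simp
    finally have "e (k - a) = target_coeff k a"
      using neg_one_power_add_eq_neg_one_power_diff[OF a, where ?'a = int]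
      by (simp add: e_def target_coeff_def)
    moreover have "e (k + a) = target_coeff k a" by (simp add: e_def target_coeff_def)
    ultimately show "?f (k + a) + ?f (k - a) = - Polynomial.smult (target_coeff k a) (symmetric_difference_poly k a)"
      using add_monom[of "target_coeff k a" k "target_coeff k a"]
      by (simp add: symmetric_difference_poly_def smult_diff_right smult_add_right smult_monom algebra_simps)
  qed
  finally show ?thesis by (simp add: sum_negf)
qed

text \<open>
  A positive representative of the residue of \<open>target_coeff k a\<close> modulo \<open>p\<close>. Adding \<open>p\<close> ensures positivity
  for \<open>a < k\<close>; for \<open>a = k\<close> the coefficient itself is 1, which makes \<open>tower_poly\<close> monic up to
  sign.
\<close>

definition loop_count :: "nat \<Rightarrow> nat \<Rightarrow> nat \<Rightarrow> nat" where
  "loop_count p k a = (if a = k then 1 else nat (target_coeff k a mod int p) + p)"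

definition tower_poly :: "nat \<Rightarrow> nat \<Rightarrow> int poly" where
  "tower_poly p k = (\<Sum>a=1..k. Polynomial.smult (int (loop_count p k a)) (symmetric_difference_poly k a))"

lemma loop_count_pos: "p > 0 \<Longrightarrow> loop_count p k a > 0"
  by (simp add: loop_count_def)

lemma loop_count_cong: "p > 0 \<Longrightarrow> int p dvd int (loop_count p k a) - target_coeff k a"
  by (auto simp: loop_count_def target_coeff_def mod_eq_dvd_iff[symmetric] simp flip: mult_2)

lemma tower_poly_mod_p:
  assumes p: "p > 0" and k: "k \<ge> 1"
  obtains w where "tower_poly p k = Polynomial.smult (-1) (X_minus_one ^ (2 * k)) + of_nat p * w"
proof -
  define u where "u a = (int (loop_count p k a) - target_coeff k a) div int p" for a
  have u: "int (loop_count p k a) = target_coeff k a + int p * u a" for a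
    using dvd_mult_div_cancel[OF loop_count_cong[OF p, of k a]] by (simp add: u_def)
  have "tower_poly p k = (\<Sum>a=1..k. Polynomial.smult (target_coeff k a) (symmetric_difference_poly k a)) +
      of_nat p * (\<Sum>a=1..k. Polynomial.smult (u a) (symmetric_difference_poly k a))"
    unfolding tower_poly_def u sum_distrib_left sum.distrib[symmetric]
    by (intro sum.cong refl) (simp add: smult_add_left of_nat_poly mult.commute)
  then have "tower_poly p k = Polynomial.smult (-1) (X_minus_one ^ (2 * k)) +
      of_nat p * (\<Sum>a=1..k. Polynomial.smult (u a) (symmetric_difference_poly k a))"
    unfolding target_combination[OF k] by simp
  then show ?thesis by (rule that)
qed

lemma lead_coeff_tower_poly:
  assumes k: "k \<ge> 1"
  shows "lead_coeff (tower_poly p k) = -1"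
proof -
  have "coeff (tower_poly p k) (2 * k) = (\<Sum>a=1..k. if a = k then -1 else 0)"
    unfolding tower_poly_def coeff_sum
    using k by (intro sum.cong refl) (auto simp: symmetric_difference_poly_def loop_count_def)
  also have "\<dots> = -1" using k by simp
  finally have c: "coeff (tower_poly p k) (2 * k) = -1" .
  have "coeff (tower_poly p k) i = 0" if "i > 2 * k" for i
    unfolding tower_poly_def coeff_sum
    using that by (intro sum.neutral) (auto simp: symmetric_difference_poly_def)
  then have "degree (tower_poly p k) \<le> 2 * k" by (intro degree_le) auto
  moreover have "degree (tower_poly p k) \<ge> 2 * k" using c by (intro le_degree) simp
  ultimately show ?thesis using c by simp
qed

lemma ev_tower_poly:
  assumes "z \<noteq> 0"
  shows "ev (tower_poly p k) z * inverse (z ^ k) =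
    (\<Sum>a=1..k. of_nat (loop_count p k a) * (2 - z ^ a - inverse (z ^ a)))"
proof -
  have "ev (symmetric_difference_poly k a) z * inverse (z ^ k) = 2 - z ^ a - inverse (z ^ a)"
    if "a \<in> {1..k}" for a
  proof -
    have "z ^ k = z ^ (k - a) * z ^ a" using that by (simp flip: power_add)
    then have "z ^ (k - a) * inverse (z ^ k) = inverse (z ^ a)" using assms by simp
    moreover have "ev (symmetric_difference_poly k a) z * inverse (z ^ k) =
        2 * (z ^ k * inverse (z ^ k)) - z ^ a * (z ^ k * inverse (z ^ k)) - z ^ (k - a) * inverse (z ^ k)"
      by (simp add: symmetric_difference_poly_def power_add algebra_simps)
    moreover have "z ^ k * inverse (z ^ k) = 1" using assms by simp
    ultimately show ?thesis by simp
  qed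
  then show ?thesis
    unfolding tower_poly_def ev_sum sum_distrib_right ev_smult
    by (intro sum.cong refl) (simp add: mult.assoc)
qed

text \<open>
  On the unit circle the sum in \<open>ev_tower_poly\<close> equals \<open>\<Sum> c\<^sub>a |1 - z^a|\<^sup>2\<close>, and its term for \<open>a = 1\<close> is
  positive.
\<close>

lemma ev_tower_poly_nonzero:
  assumes p: "p > 0" and k: "k \<ge> 1" and z: "cmod z = 1" "z \<noteq> 1"
  shows "ev (tower_poly p k) z \<noteq> 0"
proof
  assume 0: "ev (tower_poly p k) z = 0"
  have re_eq: "Re (2 - w - inverse w) = 2 - 2 * Re w" if "cmod w = 1" for w
  proof -
    have "(Re w)\<^sup>2 + (Im w)\<^sup>2 = 1" using that by (simp add: cmod_def)
    then have "inverse w = cnj w" by (simp add: complex_eq_iff)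
    then show ?thesis by simp
  qed
  have nn: "Re (2 - z ^ a - inverse (z ^ a)) \<ge> 0" for a
    using re_eq[of "z ^ a"] z(1) complex_Re_le_cmod[of "z ^ a"] by (simp add: norm_power)
  have "Re z \<noteq> 1"
  proof
    assume r: "Re z = 1"
    then have "Im z = 0" using z(1) by (simp add: cmod_def)
    then show False using r z(2) by (simp add: complex_eq_iff)
  qed
  then have pos: "Re (2 - z ^ 1 - inverse (z ^ 1)) > 0"
    using re_eq[of z] z(1) complex_Re_le_cmod[of z] by simp
  have "z \<noteq> 0" using z(1) by auto
  then have "(\<Sum>a=1..k. of_nat (loop_count p k a) * (2 - z ^ a - inverse (z ^ a))) = 0"
    using ev_tower_poly[of z p k] 0 by simp
  then have "0 = Re (\<Sum>a=1..k. of_nat (loop_count p k a) * (2 - z ^ a - inverse (z ^ a)))" by simp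
  also have "\<dots> = (\<Sum>a=1..k. of_nat (loop_count p k a) * Re (2 - z ^ a - inverse (z ^ a)))"
    unfolding Re_sum by (intro sum.cong refl) (simp add: algebra_simps)
  also have "\<dots> > 0"
    using k nn pos loop_count_pos[OF p, of k 1] by (intro sum_pos2[of _ 1]) auto
  finally show False by simp
qed

section \<open>Growth of the number of spanning trees\<close>

definition voltage_list :: "nat \<Rightarrow> nat \<Rightarrow> nat \<Rightarrow> nat list" where
  "voltage_list N p k = concat (map (\<lambda>a. replicate (N * loop_count p k a) a) [1..<Suc k])"

lemma sum_voltage_list:
  fixes f :: "nat \<Rightarrow> complex"
  shows "(\<Sum>i<length (voltage_list N p k). f (voltage_list N p k ! i)) =
    of_nat N * (\<Sum>a=1..k. of_nat (loop_count p k a) * f a)"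
proof -
  have rep: "(\<Sum>x\<leftarrow>concat (map (\<lambda>a. replicate (c a) a) ys). f x) = (\<Sum>a\<leftarrow>ys. of_nat (c a) * f a)" for c ys
    by (induction ys) (simp_all add: sum_list_replicate)
  have "(\<Sum>i<length (voltage_list N p k). f (voltage_list N p k ! i)) = (\<Sum>x\<leftarrow>voltage_list N p k. f x)"
    by (simp add: sum_list_sum_nth atLeast0LessThan)
  also have "\<dots> = (\<Sum>a\<leftarrow>[1..<Suc k]. of_nat (N * loop_count p k a) * f a)"
    unfolding voltage_list_def by (rule rep)
  also have "\<dots> = (\<Sum>a=1..k. of_nat (N * loop_count p k a) * f a)"
    by (simp only: interv_sum_list_conv_sum_set_nat set_upt atLeastLessThanSuc_atLeastAtMost)
  finally show ?thesis by (simp add: sum_distrib_left mult.assoc)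
qed

lemma prod_over_levels:
  fixes f :: "complex \<Rightarrow> 'a::comm_monoid_mult"
  assumes p: "p \<ge> 2"
  shows "(\<Prod>z | z ^ p ^ n = 1 \<and> z \<noteq> 1. f z) = (\<Prod>m<n. \<Prod>z\<in>level_roots p m. f z)"
proof (induction n)
  case 0
  have "{z::complex. z ^ p ^ 0 = 1 \<and> z \<noteq> 1} = {}" by auto
  then show ?case by (simp only: prod.empty lessThan_0)
next
  case (Suc n)
  let ?R = "\<lambda>n. {z::complex. z ^ p ^ n = 1 \<and> z \<noteq> 1}"
  have "finite {z::complex. z ^ p ^ n = 1}" using p by (intro finite_roots_unity) (simp add: Suc_le_eq)
  then have fin: "finite (?R n)" by (rule rev_finite_subset) auto
  have "?R (Suc n) = ?R n \<union> level_roots p n"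
    by (auto simp: level_roots_def power_mult mult.commute[of p])
  moreover have "?R n \<inter> level_roots p n = {}" by (auto simp: level_roots_def)
  ultimately have "prod f (?R (Suc n)) = prod f (?R n) * prod f (level_roots p n)"
    using fin card_level_roots(2)[OF p] by (simp add: prod.union_disjoint)
  then show ?case using Suc by simp
qed

abbreviation level_norm :: "nat \<Rightarrow> nat \<Rightarrow> nat \<Rightarrow> int" where
  "level_norm p k m \<equiv> monic_root_set.root_norm (level_roots p m) (tower_poly p k)"

lemma level_norm_nonzero:
  assumes p: "prime p" and k: "k \<ge> 1"
  shows "level_norm p k m \<noteq> 0"
proof -
  interpret p_power_level p m by unfold_locales (rule p)
  have p0: "p > 0" using p prime_gt_0_nat by blast
  have "ev (tower_poly p k) z \<noteq> 0" if "z \<in> level_roots p m" for z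
  proof (rule ev_tower_poly_nonzero[OF p0 k])
    have z: "z ^ p ^ Suc m = 1" "z ^ p ^ m \<noteq> 1" using that by (auto simp: level_roots_def)
    show "cmod z = 1" using power_eq_1_iff[OF z(1)] p0 by auto
    show "z \<noteq> 1" using z(2) by auto
  qed
  then have "complex_of_int (level_norm p k m) \<noteq> 0"
    using fin by (simp add: of_int_root_norm)
  then show ?thesis by simp
qed

text \<open>
  The product formula for \<open>p\<^sup>n \<cdot> \<kappa>(X\<^sub>n)\<close>, sorted by the orders of the roots of unity. Taking absolute
  values removes the factors \<open>z^-k\<close>.
\<close>

lemma kappa_tower:
  fixes p k N n :: nat
  assumes p: "prime p" and k: "k \<ge> 1"
  defines "xs \<equiv> voltage_list N p k"
  shows "int (p ^ n * num_spanning_trees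
      (derived_graph p (Zp p) (bouquet xs) (\<lambda>e. Zp_of_int p (voltage xs e)) n)
      (derived_arev p (Zp p) (bouquet xs) (bouquet_rev xs) (\<lambda>e. Zp_of_int p (voltage xs e)) n)) =
    int N ^ (p ^ n - 1) * (\<Prod>m<n. \<bar>level_norm p k m\<bar>)"
proof -
  have p2: "p \<ge> 2" and p0: "p > 0" using p prime_ge_2_nat prime_gt_0_nat by blast+
  interpret bouquet_tower p xs n by unfold_locales (rule p0)
  let ?R = "{z::complex. z ^ p ^ n = 1 \<and> z \<noteq> 1}" and ?G = "tower_poly p k"
  let ?\<kappa> = "num_spanning_trees X\<^sub>n rev\<^sub>n"
  have fin1: "finite {z::complex. z ^ p ^ n = 1}" using p2 by (intro finite_roots_unity) (simp add: Suc_le_eq)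
  have "card {z::complex. z ^ p ^ n = 1} = p ^ n" using p0 by (intro card_roots_unity_eq) simp
  moreover have "?R = {z. z ^ p ^ n = 1} - {1}" by auto
  ultimately have cardR: "card ?R = p ^ n - 1" using fin1 by (simp add: card_Diff_singleton)
  have "of_nat (p ^ n) * of_nat ?\<kappa> = (\<Prod>z\<in>?R. of_nat N * (ev ?G z * inverse (z ^ k)))"
    unfolding spanning_trees_product
  proof (intro prod.cong refl)
    fix z :: complex assume "z \<in> ?R"
    then have "z ^ p ^ n = 1" by simp
    then have z0: "z \<noteq> 0" using q_pos by (auto simp: power_0_left)
    show "(\<Sum>i<length xs. 2 - z ^ (xs ! i) - inverse (z ^ (xs ! i))) = of_nat N * (ev ?G z * inverse (z ^ k))"
      unfolding xs_def ev_tower_poly[OF z0] by (rule sum_voltage_list)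
  qed
  then have "cmod (of_nat (p ^ n) * of_nat ?\<kappa>) = (\<Prod>z\<in>?R. cmod (of_nat N * (ev ?G z * inverse (z ^ k))))"
    by (simp only: prod_norm[symmetric])
  also have "\<dots> = (\<Prod>z\<in>?R. real N * cmod (ev ?G z))"
  proof (intro prod.cong refl)
    fix z :: complex assume "z \<in> ?R"
    then have "z ^ p ^ n = 1" by simp
    then have "cmod z = 1" using power_eq_1_iff[of z "p ^ n"] p0 by auto
    then show "cmod (of_nat N * (ev ?G z * inverse (z ^ k))) = real N * cmod (ev ?G z)"
      by (simp add: norm_mult norm_inverse norm_power)
  qed
  also have "\<dots> = real N ^ (p ^ n - 1) * (\<Prod>m<n. \<Prod>z\<in>level_roots p m. cmod (ev ?G z))"
    by (simp only: prod.distrib prod_constant cardR prod_over_levels[OF p2])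
  also have "(\<lambda>m. \<Prod>z\<in>level_roots p m. cmod (ev ?G z)) = (\<lambda>m. real_of_int \<bar>level_norm p k m\<bar>)"
  proof
    fix m
    interpret level: p_power_level p m by unfold_locales (rule p)
    have "(\<Prod>z\<in>level_roots p m. cmod (ev ?G z)) = cmod (of_int (level_norm p k m))"
      by (simp only: level.of_int_root_norm prod_norm)
    then show "(\<Prod>z\<in>level_roots p m. cmod (ev ?G z)) = real_of_int \<bar>level_norm p k m\<bar>" by simp
  qed
  finally have "real_of_int (int (p ^ n * ?\<kappa>)) = real_of_int (int N ^ (p ^ n - 1) * (\<Prod>m<n. \<bar>level_norm p k m\<bar>))"
    by (simp add: norm_mult norm_power)
  then show ?thesis by (simp only: of_int_eq_iff)
qed

lemma multiplicity_int: "multiplicity (int l) (int x) = multiplicity l x"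
proof -
  have "int l ^ n dvd int x \<longleftrightarrow> l ^ n dvd x" for n
    by (simp flip: of_nat_power)
  then show ?thesis by (simp add: multiplicity_def)
qed

lemma eventually_linear_sum:
  fixes f :: "nat \<Rightarrow> nat"
  assumes "\<And>m. m \<ge> M \<Longrightarrow> f m = s"
  shows "\<exists>c. \<forall>\<^sub>F n in sequentially. int (\<Sum>m<n. f m) = int s * int n + c"
proof (intro exI eventually_sequentiallyI)
  fix n assume "n \<ge> M"
  then show "int (\<Sum>m<n. f m) = int s * int n + (int (\<Sum>m<M. f m) - int s * int M)"
  proof (induction n rule: dec_induct)
    case (step n)
    then show ?case using assms[of n] by (simp add: algebra_simps)
  qed simp
qed

lemma multiplicity_kappa:
  fixes p k N n :: nat
  assumes p: "prime p" and k: "k \<ge> 1" and N: "N > 0" and l: "prime l"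
  defines "xs \<equiv> voltage_list N p k"
  shows "int (ord_kappa l p (Zp p) (bouquet xs) (bouquet_rev xs) (\<lambda>e. Zp_of_int p (voltage xs e)) n) =
    int (multiplicity l N) * (int p ^ n - 1) + int (\<Sum>m<n. multiplicity (int l) (level_norm p k m)) -
    (if l = p then int n else 0)" (is "int ?o = _")
    and "num_spanning_trees (derived_graph p (Zp p) (bouquet xs) (\<lambda>e. Zp_of_int p (voltage xs e)) n)
      (derived_arev p (Zp p) (bouquet xs) (bouquet_rev xs) (\<lambda>e. Zp_of_int p (voltage xs e)) n) \<noteq> 0"
      (is "?\<kappa> \<noteq> 0")
proof -
  have p0: "p > 0" using p prime_gt_0_nat by blast
  have pe: "prime_elem (int l)" using l by simp
  have nz: "(\<Prod>m<n. \<bar>level_norm p k m\<bar>) \<noteq> 0"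
    using level_norm_nonzero[OF p k] by simp
  have eq: "int (p ^ n * ?\<kappa>) = int N ^ (p ^ n - 1) * (\<Prod>m<n. \<bar>level_norm p k m\<bar>)"
    unfolding xs_def by (rule kappa_tower[OF p k])
  then have "int (p ^ n * ?\<kappa>) \<noteq> 0" using nz N by simp
  then show \<kappa>0: "?\<kappa> \<noteq> 0" by simp
  have left: "multiplicity (int l) (int (p ^ n * ?\<kappa>)) = n * multiplicity l p + ?o"
    using \<kappa>0 p0 l unfolding multiplicity_int ord_kappa_def
    by (simp add: prime_elem_multiplicity_mult_distrib prime_elem_multiplicity_power_distrib)
  have right: "multiplicity (int l) (int N ^ (p ^ n - 1) * (\<Prod>m<n. \<bar>level_norm p k m\<bar>)) =
      (p ^ n - 1) * multiplicity l N + (\<Sum>m<n. multiplicity (int l) (level_norm p k m))"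
  proof -
    have "multiplicity (int l) (\<Prod>m<n. \<bar>level_norm p k m\<bar>) = (\<Sum>m<n. multiplicity (int l) \<bar>level_norm p k m\<bar>)"
      using level_norm_nonzero[OF p k] by (intro prime_elem_multiplicity_prod_distrib pe) auto
    also have "\<dots> = (\<Sum>m<n. multiplicity (int l) (level_norm p k m))"
      by (intro sum.cong refl) (metis multiplicity_normalize_right normalize_int_def)
    finally show ?thesis
      using N nz pe by (simp add: prime_elem_multiplicity_mult_distrib
        prime_elem_multiplicity_power_distrib multiplicity_int)
  qed
  have "n * multiplicity l p + ?o =
      (p ^ n - 1) * multiplicity l N + (\<Sum>m<n. multiplicity (int l) (level_norm p k m))"
    using left right unfolding eq by (simp only:)
  moreover have "int (p ^ n - 1) = int p ^ n - 1" using p0 by (simp add: of_nat_diff)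
  ultimately have "int n * int (multiplicity l p) + int ?o =
      (int p ^ n - 1) * int (multiplicity l N) + int (\<Sum>m<n. multiplicity (int l) (level_norm p k m))"
    by (metis of_nat_add of_nat_mult)
  moreover have "multiplicity l p = (if l = p then 1 else 0)"
    using p l by (auto simp: prime_multiplicity_other)
  ultimately show "int ?o = int (multiplicity l N) * (int p ^ n - 1) +
      int (\<Sum>m<n. multiplicity (int l) (level_norm p k m)) - (if l = p then int n else 0)"
    by (simp add: mult.commute split: if_splits)
qed

text \<open>
  The level is high enough as soon as the degree \<open>(p - 1) p^m\<close> of the roots of unity exceeds \<open>2 k\<close>.
\<close>

lemma level_norm_p_multiplicity:
  assumes p: "prime p" and k: "k \<ge> 1" and m: "m \<ge> 2 * k"
  shows "multiplicity (int p) (level_norm p k m) = 2 * k"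
proof -
  interpret p_power_level p m by unfold_locales (rule p)
  have p2: "p \<ge> 2" using p prime_ge_2_nat by blast
  obtain w where w: "tower_poly p k = Polynomial.smult (-1) (X_minus_one ^ (2 * k)) + of_nat p * w"
    using tower_poly_mod_p[OF _ k, of p] p2 by auto
  have "2 * k < 2 ^ (2 * k)" by (rule less_exp)
  also have "\<dots> \<le> 2 ^ m" using m by (intro power_increasing) auto
  also have "\<dots> \<le> p ^ m" using p2 by (intro power_mono) auto
  also have "\<dots> \<le> (p - 1) * p ^ m" using p2 by simp
  finally show ?thesis by (intro multiplicity_root_norm_p[OF w]) simp_all
qed

lemma level_norm_coprime_eventually:
  assumes p: "prime p" and k: "k \<ge> 1" and l: "prime l" "l \<noteq> p"
  shows "\<exists>M. \<forall>m\<ge>M. \<not> int l dvd level_norm p k m"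
proof -
  have "\<bar>lead_coeff (tower_poly p k)\<bar> = 1" using lead_coeff_tower_poly[OF k] by simp
  moreover have "int l > 0" using l prime_gt_0_nat by simp
  ultimately obtain i j :: nat and a b where ij: "i < j"
    and rel: "monom 1 j - monom 1 i = Polynomial.smult (int l) a + tower_poly p k * b"
    by (rule powers_eventually_congruent)
  have "\<not> int l dvd level_norm p k m" if "m \<ge> j" for m
  proof -
    interpret p_power_level p m by unfold_locales (rule p)
    have "j < 2 ^ j" by (rule less_exp)
    also have "\<dots> \<le> 2 ^ Suc m" using that by (intro power_increasing) auto
    also have "\<dots> \<le> p ^ Suc m" using prime_ge_2_nat[OF p] by (intro power_mono) auto
    finally show ?thesis by (rule root_norm_coprime_other[OF l ij _ rel])
  qed
  then show ?thesis by blast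
qed

theorem theorem5p2:
  fixes p :: nat and lam :: nat and mu :: "nat \<Rightarrow> nat"
  assumes "prime p"
    and "odd lam" and "lam \<ge> 1"
    and "finite {l. prime l \<and> mu l \<noteq> 0}"
  shows "\<exists>(\<Gamma> :: (nat \<Rightarrow> int) monoid) (X :: (nat, nat) pre_digraph) arev \<alpha>.
           Zp_covering p \<Gamma> X arev \<alpha> \<and>
           card (verts X) = 1 \<and>
           lambda_inv p \<Gamma> X arev \<alpha> = lam \<and>
           (\<forall>l. prime l \<longrightarrow> mu_inv l p \<Gamma> X arev \<alpha> = mu l)"
proof -
  note p = assms(1)
  have p2: "p \<ge> 2" using p prime_ge_2_nat by blast
  obtain h where h: "lam = 2 * h + 1" using assms(2) by (elim oddE)
  define k where "k = Suc h"
  have k: "k \<ge> 1" and lam: "2 * k = lam + 1" by (simp_all add: k_def h)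
  let ?S = "{l. prime l \<and> mu l \<noteq> 0}"
  define N where "N = (\<Prod>l\<in>?S. l ^ mu l)"
  have N: "N > 0" unfolding N_def by (intro prod_pos) (auto simp: prime_gt_0_nat)
  have mult_N: "multiplicity l N = mu l" if "prime l" for l
    unfolding N_def using multiplicity_prod_prime_powers[OF assms(4) _ that, of mu] that by auto
  define xs where "xs = voltage_list N p k"
  define \<alpha> where "\<alpha> = (\<lambda>e. Zp_of_int p (voltage xs e))"
  have cov: "Zp_covering p (Zp p) (bouquet xs) (bouquet_rev xs) \<alpha>"
    unfolding \<alpha>_def
  proof (rule Zp_covering_bouquet)
    show "p > 0" using p2 by simp
  qed (unfold xs_def, rule multiplicity_kappa(2)[OF p k N p])
  have growth: "\<exists>nu. growth p (ord_kappa l p (Zp p) (bouquet xs) (bouquet_rev xs) \<alpha>)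
      (if l = p then lam else 0) (mu l) nu" if l: "prime l" for l
  proof -
    let ?s = "if l = p then 2 * k else 0"
    have "\<exists>M. \<forall>m\<ge>M. multiplicity (int l) (level_norm p k m) = ?s"
    proof (cases "l = p")
      case True
      then show ?thesis using level_norm_p_multiplicity[OF p k] by auto
    next
      case False
      obtain M where "\<And>m. m \<ge> M \<Longrightarrow> \<not> int l dvd level_norm p k m"
        using level_norm_coprime_eventually[OF p k l False] by blast
      then show ?thesis using False by (intro exI[of _ M]) (simp add: not_dvd_imp_multiplicity_0)
    qed
    then obtain c where c: "\<forall>\<^sub>F n in sequentially.
        int (\<Sum>m<n. multiplicity (int l) (level_norm p k m)) = int ?s * int n + c"
      using eventually_linear_sum[of _ "\<lambda>m. multiplicity (int l) (level_norm p k m)" ?s] by blast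
    have "growth p (ord_kappa l p (Zp p) (bouquet xs) (bouquet_rev xs) \<alpha>)
        (if l = p then lam else 0) (mu l) (c - int (mu l))"
      unfolding growth_def
    proof (rule eventually_mono[OF c])
      fix n assume n: "int (\<Sum>m<n. multiplicity (int l) (level_norm p k m)) = int ?s * int n + c"
      have "int (2 * k) = int lam + 1" using lam by simp
      then show "int (ord_kappa l p (Zp p) (bouquet xs) (bouquet_rev xs) \<alpha> n) =
          int (if l = p then lam else 0) * int n + int (mu l) * int p ^ n + (c - int (mu l))"
        unfolding \<alpha>_def xs_def multiplicity_kappa(1)[OF p k N l] n mult_N[OF l]
        by (auto simp: algebra_simps)
    qed
    then show ?thesis by blast
  qed
  have "lambda_inv p (Zp p) (bouquet xs) (bouquet_rev xs) \<alpha> = lam"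
    using growth[OF p] lambda_inv_eqI[OF p2] by auto
  moreover have "mu_inv l p (Zp p) (bouquet xs) (bouquet_rev xs) \<alpha> = mu l" if l: "prime l" for l
  proof -
    obtain nu where "growth p (ord_kappa l p (Zp p) (bouquet xs) (bouquet_rev xs) \<alpha>)
        (if l = p then lam else 0) (mu l) nu"
      using growth[OF l] by blast
    then show ?thesis by (rule mu_inv_eqI[OF p2]) simp
  qed
  moreover have "card (verts (bouquet xs)) = 1" by (simp add: bouquet_def)
  ultimately show ?thesis using cov by blast
qed

end
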